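(* Let $M\geq2$, $s>0$, let $\mathsf{A}=(A_1,\ldots,A_M)\in M_d(\mathbb{R})^M$ be irreducible, and let $\mu$ be the unique equilibrium state of $(\mathsf{A},s)$. Then $\mu$ is fully supported on $\Sigma_M$ if and only if the zero matrix does not belong to $\mathcal{S}(\mathsf{A})$.
   Context: $\Sigma_M:=\{1,\ldots,M\}^{\mathbb{N}}$ with the product topology; $\sigma$ is the shift $\sigma[(x_n)_{n=1}^\infty]=(x_{n+1})_{n=1}^\infty$; $\mathcal{M}_\sigma$ is the set of $\sigma$-invariant Borel probability measures on $\Sigma_M$; $h(\nu)$ is the metric entropy of $\nu\in\mathcal{M}_\sigma$. $M_d(\mathbb{R})$ is the set of real $d\times d$ matrices and $\|\cdot\|$ is the operator norm induced by the Euclidean norm. The top Lyapunov exponent is $\Lambda(\mathsf{A},\nu):=\lim_{n\to\infty}\frac1n\int_{\Sigma_M}\log\|A_{x_n}\cdots A_{x_1}\|\,d\nu(x)\in[-\infty,\infty)$ (with $\log 0=-\infty$). An equilibrium state of $(\mathsf{A},s)$ is a measure $\mu\in\mathcal{M}_\sigma$ attaining $\sup_{\nu\in\mathcal{M}_\sigma}\bigl(h(\nu)+s\Lambda(\mathsf{A},\nu)\bigr)$. $\mathsf{A}$ is irreducible if there is no linear subspace $U\subset\mathbb{R}^d$ with $0<\dim U<d$ and $A_iU\subseteq U$ for all $i$. It is known (Feng–Käenmäki) that if $d\geq2$ and $\mathsf{A}$ is irreducible then $(\mathsf{A},s)$ has exactly one equilibrium state. $\mathcal{S}(\mathsf{A})$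 is the semigroup generated by $A_1,\ldots,A_M$. *)

theory Defs
  imports "HOL-Probability.Probability"
begin

text \<open>The alphabet \<open>{1,\<dots>,M}\<close> is a finite type \<open>'m\<close> with \<open>M = CARD('m)\<close>.
  Sequences are indexed from \<open>0\<close>, so \<open>x n\<close> stands for the entry usually written \<open>x\<^sub>n\<^sub>+\<^sub>1\<close>.\<close>

definition full_shift :: "(nat \<Rightarrow> 'm) topology" where
  "full_shift = product_topology (\<lambda>_. discrete_topology UNIV) UNIV"

definition shift :: "(nat \<Rightarrow> 'm) \<Rightarrow> nat \<Rightarrow> 'm" where
  "shift x = (\<lambda>n. x (Suc n))"

definition borel_of_topology :: "'a topology \<Rightarrow> 'a measure" where
  "borel_of_topology X = sigma (topspace X) {U. openin X U}"

definition topological_support :: "'a topology \<Rightarrow> 'a measure \<Rightarrow> 'a set" where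
  "topological_support X \<nu> =
    {x \<in> topspace X. \<forall>U. openin X U \<and> x \<in> U \<longrightarrow> emeasure \<nu> U > 0}"

definition fully_supported :: "(nat \<Rightarrow> 'm) measure \<Rightarrow> bool" where
  "fully_supported \<nu> \<longleftrightarrow> topological_support full_shift \<nu> = topspace full_shift"

lemma topspace_full_shift [simp]: "topspace full_shift = UNIV"
  by (simp add: full_shift_def)

lemma continuous_map_shift: "continuous_map full_shift full_shift shift"
  unfolding full_shift_def shift_def
  by (auto simp: continuous_map_componentwise intro: continuous_map_product_projection)

text \<open>In particular the push-forward \<open>distr \<nu> \<nu> shift\<close> below is not degenerate.\<close>

lemma measurable_shift:
  "shift \<in> borel_of_topology full_shift \<rightarrow>\<^sub>M borel_of_topology full_shift"
  unfolding borel_of_topology_def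
proof (rule measurable_sigma_sets[of _ "topspace full_shift" "{U. openin full_shift U}"])
  fix U :: "(nat \<Rightarrow> 'a) set"
  assume "U \<in> {U. openin full_shift U}"
  then have "openin full_shift {x \<in> topspace full_shift. shift x \<in> U}"
    using continuous_map_shift unfolding continuous_map_def by blast
  then show "shift -` U \<inter> space (sigma (topspace full_shift) {U. openin full_shift U})
      \<in> sets (sigma (topspace full_shift) {U. openin full_shift U})"
    by (simp add: vimage_def sets_measure_of sigma_sets.Basic)
qed (auto simp: sets_measure_of)

definition invariant_measures :: "(nat \<Rightarrow> 'm) measure set" where
  "invariant_measures =
    {\<nu>. sets \<nu> = sets (borel_of_topology full_shift) \<and> prob_space \<nu> \<and> distr \<nu> \<nu> shift = \<nu>}"

definition measurable_partition :: "'a measure \<Rightarrow> 'a set set \<Rightarrow> bool" where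
  "measurable_partition \<nu> P \<longleftrightarrow> partition_on (space \<nu>) P \<and> finite P \<and> P \<subseteq> sets \<nu>"

definition partition_entropy :: "'a measure \<Rightarrow> 'a set set \<Rightarrow> real" where
  "partition_entropy \<nu> P = - (\<Sum>p\<in>P. measure \<nu> p * ln (measure \<nu> p))"

definition preimage_partition :: "'a measure \<Rightarrow> ('a \<Rightarrow> 'a) \<Rightarrow> 'a set set \<Rightarrow> 'a set set" where
  "preimage_partition \<nu> T P = (\<lambda>p. T -` p \<inter> space \<nu>) ` P"

text \<open>The join of \<open>T\<^sup>-\<^sup>iP\<close> over \<open>i < n\<close>; \<^const>\<open>common_refinement\<close> discards the empty set.\<close>

definition iterated_join ::
    "'a measure \<Rightarrow> ('a \<Rightarrow> 'a) \<Rightarrow> 'a set set \<Rightarrow> nat \<Rightarrow> 'a set set" where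
  "iterated_join \<nu> T P n = common_refinement ((\<lambda>i. preimage_partition \<nu> (T ^^ i) P) ` {..<n})"

definition entropy_wrt_partition :: "'a measure \<Rightarrow> ('a \<Rightarrow> 'a) \<Rightarrow> 'a set set \<Rightarrow> real" where
  "entropy_wrt_partition \<nu> T P =
    lim (\<lambda>n. (1 / real n) * partition_entropy \<nu> (iterated_join \<nu> T P n))"

definition metric_entropy :: "'a measure \<Rightarrow> ('a \<Rightarrow> 'a) \<Rightarrow> ereal" where
  "metric_entropy \<nu> T = (SUP P\<in>{P. measurable_partition \<nu> P}. ereal (entropy_wrt_partition \<nu> T P))"

definition ereal_ln :: "real \<Rightarrow> ereal" where
  "ereal_ln r = (if r = 0 then - \<infinity> else ereal (ln r))"

text \<open>\<^const>\<open>e2ennreal\<close> truncates at \<open>0\<close>, so this is the integral of the positive part minus that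
  of the negative part; it is meaningful when one of the two is finite. Below the integrand is
  bounded above.\<close>

definition extended_integral :: "'a measure \<Rightarrow> ('a \<Rightarrow> ereal) \<Rightarrow> ereal" where
  "extended_integral \<nu> f =
    enn2ereal (\<integral>\<^sup>+x. e2ennreal (f x) \<partial>\<nu>) - enn2ereal (\<integral>\<^sup>+x. e2ennreal (- f x) \<partial>\<nu>)"

definition op_norm :: "real ^ 'd ^ 'd \<Rightarrow> real" where
  "op_norm B = onorm (\<lambda>v. B *v v)"

text \<open>\<open>cocycle A x n = A (x (n - 1)) ** \<dots> ** A (x 0)\<close>: later entries multiply on the left.\<close>

primrec cocycle ::
    "('m \<Rightarrow> real ^ 'd ^ 'd) \<Rightarrow> (nat \<Rightarrow> 'm) \<Rightarrow> nat \<Rightarrow> real ^ 'd ^ 'd" where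
  "cocycle A x 0 = mat 1"
| "cocycle A x (Suc n) = A (x n) ** cocycle A x n"

definition lyapunov_exponent ::
    "('m \<Rightarrow> real ^ 'd ^ 'd) \<Rightarrow> (nat \<Rightarrow> 'm) measure \<Rightarrow> ereal" where
  "lyapunov_exponent A \<nu> =
    lim (\<lambda>n. ereal (1 / real n) * extended_integral \<nu> (\<lambda>x. ereal_ln (op_norm (cocycle A x n))))"

definition free_energy ::
    "('m \<Rightarrow> real ^ 'd ^ 'd) \<Rightarrow> real \<Rightarrow> (nat \<Rightarrow> 'm) measure \<Rightarrow> ereal" where
  "free_energy A s \<nu> = metric_entropy \<nu> shift + ereal s * lyapunov_exponent A \<nu>"

definition equilibrium_state ::
    "('m \<Rightarrow> real ^ 'd ^ 'd) \<Rightarrow> real \<Rightarrow> (nat \<Rightarrow> 'm) measure \<Rightarrow> bool" where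
  "equilibrium_state A s \<mu> \<longleftrightarrow>
    \<mu> \<in> invariant_measures \<and> free_energy A s \<mu> = (SUP \<nu>\<in>invariant_measures. free_energy A s \<nu>)"

definition irreducible_tuple :: "('m \<Rightarrow> real ^ 'd ^ 'd) \<Rightarrow> bool" where
  "irreducible_tuple A \<longleftrightarrow>
    \<not> (\<exists>U :: (real ^ 'd) set. subspace U \<and> 0 < dim U \<and> dim U < CARD('d) \<and>
          (\<forall>i. (\<lambda>v. A i *v v) ` U \<subseteq> U))"

text \<open>A semigroup, not a monoid: the empty product is not included.\<close>

inductive_set generated_semigroup ::
    "('m \<Rightarrow> real ^ 'd ^ 'd) \<Rightarrow> (real ^ 'd ^ 'd) set"
  for A :: "'m \<Rightarrow> real ^ 'd ^ 'd" where
  gen: "A i \<in> generated_semigroup A"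
| mult: "B \<in> generated_semigroup A \<Longrightarrow> C \<in> generated_semigroup A \<Longrightarrow>
    B ** C \<in> generated_semigroup A"

end

theory Submission
  imports Defs "HOL-Complex_Analysis.Great_Picard"
begin

text \<open>
  \<^emph>\<open>A vanishing product.\<close> Suppose that \<open>\<mu>\<close> is fully supported and that the product along some word
  \<open>w\<close> is zero. Then \<open>\<mu>\<close> charges the cylinder of \<open>w\<close>, on which the cocycle is eventually zero, so the
  Lyapunov exponent of \<open>\<mu>\<close> is \<open>-\<infinity>\<close>. Since the entropy of \<open>\<mu>\<close> is finite (\<open>metric_entropy_shift\<close>), its
  free energy, which is the supremum over all invariant measures, is \<open>-\<infinity>\<close>
  (\<open>free_energy_zero_word\<close>). So every invariant measure is an equilibrium state. The point mass at a
  constant sequence is one that is not fully supported, which contradicts uniqueness.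

  \<^emph>\<open>No vanishing product.\<close> By uniqueness it suffices to construct one equilibrium state that charges
  every cylinder (\<open>gibbs_equilibrium_state\<close>). Put \<open>N w = \<parallel>A\<^sub>w\<parallel>\<^sup>s > 0\<close>. Irreducibility and compactness
  provide finitely many words such that for all \<open>u\<close>, \<open>v\<close> one of them, \<open>\<kappa>\<close>, satisfies
  \<open>N (u @ \<kappa> @ v) \<ge> c * N u * N v\<close> (\<open>irreducible_quasi_multiplicative\<close>). With \<open>Z n\<close> the sum of \<open>N\<close> over the
  words of length \<open>n\<close>, this and submultiplicativity make \<open>Z n\<close> comparable to \<open>exp (n * L)\<close> for some \<open>L\<close>
  (\<open>pressure_exists\<close>), and make the sums
    \<open>exp (- (j + length w + k) * L) * (\<Sum>\<^sub>u \<Sum>\<^sub>v N (u @ w @ v))\<close>, over \<open>length u = j\<close> and \<open>length v = k\<close>,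
  lie between two positive bounds that depend on \<open>w\<close> only. Summing over a letter added to \<open>w\<close> on the
  right or on the left turns \<open>k\<close> into \<open>k + 1\<close> or \<open>j\<close> into \<open>j + 1\<close>, so a limit of averages over \<open>j\<close> and
  \<open>k\<close> is a positive weight on words that defines a shift-invariant measure (\<open>gibbs_weights\<close>,
  \<open>invariant_measure_of_weights\<close>).

  That measure is an equilibrium state. For every invariant measure, the Gibbs inequality
  bounds the entropy of the words of length \<open>n\<close> plus the mean of \<open>ln (N w)\<close> by \<open>ln (Z n)\<close>. Dividing by \<open>n\<close>
  bounds the free energy by \<open>L\<close>. For the constructed measure, whose weights are at most
  \<open>D * exp (- n * L) * N w\<close>, the same quantity is at least \<open>n * L - ln D\<close>, so its free energy is \<open>L\<close>.

  Metric entropy is a supremum over all finite partitions. To replace it by the growth rate of the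
  entropy of words one needs the Kolmogorov--Sinai theorem (\<open>metric_entropy_generator\<close>). It is derived
  from the submodularity of Shannon entropy and the approximation of measurable sets by finite unions of
  cylinders.
\<close>

section \<open>Subadditive sequences\<close>

lemma subadditive_multiple_le:
  fixes a :: "nat \<Rightarrow> real"
  assumes sub: "\<And>m n. a (m + n) \<le> a m + a n"
  shows "a (q * m + r) \<le> real q * a m + a r"
proof (induction q)
  case (Suc q)
  have "a (Suc q * m + r) = a (m + (q * m + r))"
    by (simp add: add.assoc)
  also have "\<dots> \<le> a m + a (q * m + r)"
    by (rule sub)
  finally show ?case
    using Suc by (simp add: algebra_simps)
qed simp

text \<open>Fekete's lemma. The limit is taken in the extended reals because it may be \<open>-\<infinity>\<close> for the
  logarithms of the norms of a cocycle.\<close>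

lemma fekete_ereal:
  fixes a :: "nat \<Rightarrow> real"
  assumes sub: "\<And>m n. a (m + n) \<le> a m + a n"
  shows "(\<lambda>n. ereal (a n / real n)) \<longlonglongrightarrow> (INF m\<in>{1..}. ereal (a m / real m))"
proof (rule order_tendstoI)
  fix y assume y: "y < (INF m\<in>{1..}. ereal (a m / real m))"
  have "\<forall>n\<ge>1. y < ereal (a n / real n)"
    using less_INF_D[OF y] by auto
  then show "eventually (\<lambda>n. y < ereal (a n / real n)) sequentially"
    using eventually_sequentially by blast
next
  fix y assume "(INF m\<in>{1..}. ereal (a m / real m)) < y"
  then obtain m where m: "m \<ge> 1" "ereal (a m / real m) < y"
    by (auto simp: INF_less_iff)
  define B where "B = Max ((\<lambda>r. \<bar>a r\<bar>) ` {..<m})"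
  have B: "\<bar>a r\<bar> \<le> B" if "r < m" for r
    unfolding B_def using that by (intro Max_ge) auto
  \<comment> \<open>Division with remainder by \<open>m\<close> leaves an error of order \<open>1 / n\<close>.\<close>
  have bound: "a n / real n \<le> a m / real m + (\<bar>a m\<bar> + B) / real n" if "n \<ge> 1" for n
  proof -
    have "a n = a (n div m * m + n mod m)"
      by simp
    also have "\<dots> \<le> real (n div m) * a m + a (n mod m)"
      by (rule subadditive_multiple_le[OF sub])
    also have "\<dots> \<le> real (n div m) * a m + B"
      using B[of "n mod m"] m by auto
    finally have 1: "a n \<le> real (n div m) * a m + B" .
    have nm: "real n = real (n div m) * real m + real (n mod m)"
      by (metis div_mult_mod_eq of_nat_add of_nat_mult)
    have "real (n div m) * a m = (real n / real m) * a m - real (n mod m) / real m * a m"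
      using m nm by (simp add: field_simps)
    moreover have "\<bar>real (n mod m) / real m * a m\<bar> \<le> 1 * \<bar>a m\<bar>"
      unfolding abs_mult using m
      by (intro mult_right_mono) (auto simp: divide_simps)
    ultimately have "a n \<le> (real n / real m) * a m + (\<bar>a m\<bar> + B)"
      using 1 by linarith
    then have "a n / real n \<le> ((real n / real m) * a m + (\<bar>a m\<bar> + B)) / real n"
      by (rule divide_right_mono) simp
    also have "\<dots> = a m / real m + (\<bar>a m\<bar> + B) / real n"
      using that m by (simp add: field_simps)
    finally show ?thesis .
  qed
  have "(\<lambda>n. a m / real m + (\<bar>a m\<bar> + B) / real n) \<longlonglongrightarrow> a m / real m + 0"
    by (intro tendsto_add tendsto_const lim_const_over_n)
  then have "(\<lambda>n. ereal (a m / real m + (\<bar>a m\<bar> + B) / real n)) \<longlonglongrightarrow> ereal (a m / real m)"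
    by simp
  then have "eventually (\<lambda>n. ereal (a m / real m + (\<bar>a m\<bar> + B) / real n) < y) sequentially"
    using m(2) by (rule order_tendstoD)
  then show "eventually (\<lambda>n. ereal (a n / real n) < y) sequentially"
    using eventually_ge_at_top[of 1]
  proof eventually_elim
    case (elim n)
    then show ?case
      using bound[of n] by (meson ereal_less_eq(3) le_less_trans)
  qed
qed

text \<open>A linear lower bound excludes the limit \<open>-\<infinity>\<close>; the limit then bounds the sequence from below,
  being the infimum of the quotients.\<close>

lemma fekete_real:
  fixes a :: "nat \<Rightarrow> real"
  assumes sub: "\<And>m n. a (m + n) \<le> a m + a n"
    and lower: "\<And>n. - C * real n \<le> a n"
  obtains L where "(\<lambda>n. a n / real n) \<longlonglongrightarrow> L" "\<And>n. real n * L \<le> a n"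
proof -
  define I where "I = (INF m\<in>{1..}. ereal (a m / real m))"
  have low: "- C \<le> a n / real n" if "n \<ge> 1" for n
    using lower[of n] that by (simp add: field_simps)
  have "ereal (- C) \<le> I"
    unfolding I_def using low by (intro INF_greatest) (auto simp del: uminus_ereal.simps)
  moreover have "I \<le> ereal (a 1 / real 1)"
    unfolding I_def by (intro INF_lower) auto
  ultimately obtain L where L: "I = ereal L"
    by (cases I) auto
  show thesis
  proof (rule that)
    show "(\<lambda>n. a n / real n) \<longlonglongrightarrow> L"
      using fekete_ereal[OF sub] by (simp only: L[unfolded I_def] lim_ereal)
  next
    fix n
    show "real n * L \<le> a n"
    proof (cases "n = 0")
      case True
      then show ?thesis using lower[of 0] by simp
    next
      case False
      then have "I \<le> ereal (a n / real n)"
        unfolding I_def by (intro INF_lower) auto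
      then show ?thesis
        using False L by (simp add: field_simps)
    qed
  qed
qed

section \<open>Entropy of finitely valued random variables\<close>

text \<open>The entropy of the partition into the level sets of \<open>X\<close>. Random variables are easier to join,
  compose and compare than set partitions.\<close>

definition shannon :: "'a measure \<Rightarrow> ('a \<Rightarrow> 'b) \<Rightarrow> real" where
  "shannon M X = - (\<Sum>v\<in>X ` space M.
     measure M (X -` {v} \<inter> space M) * ln (measure M (X -` {v} \<inter> space M)))"

lemma shannon_superset:
  assumes "finite S" "X ` space M \<subseteq> S"
  shows "shannon M X = - (\<Sum>v\<in>S.
     measure M (X -` {v} \<inter> space M) * ln (measure M (X -` {v} \<inter> space M)))"
proof -
  have "X -` {v} \<inter> space M = {}" if "v \<notin> X ` space M" for v
    using that by auto
  then show ?thesis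
    unfolding shannon_def using assms
    by (intro arg_cong[where f = uminus] sum.mono_neutral_left) auto
qed

lemma shannon_cong:
  assumes "\<And>x. x \<in> space M \<Longrightarrow> X x = Y x"
  shows "shannon M X = shannon M Y"
proof -
  have "X ` space M = Y ` space M" "\<And>v. X -` {v} \<inter> space M = Y -` {v} \<inter> space M"
    using assms by auto
  then show ?thesis
    by (simp add: shannon_def)
qed

context prob_space
begin

lemma shannon_eq_entropy:
  assumes "simple_function M X"
  shows "shannon M X = entropy (exp 1) (count_space (X ` space M)) X"
proof -
  interpret information_space M "exp 1"
    by unfold_locales simp
  show ?thesis
    unfolding entropy_simple_distributed[OF simple_distributedI[OF assms measure_nonneg refl]]
    by (simp add: shannon_def log_ln[symmetric])
qed

lemma shannon_nonneg: "0 \<le> shannon M X"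
proof -
  have "measure M B * ln (measure M B) \<le> 0" for B
    using measure_le_1[of B] by (cases "measure M B = 0")
      (auto simp: mult_le_0_iff zero_less_measure_iff)
  then show ?thesis
    unfolding shannon_def by (simp add: sum_nonpos)
qed

text \<open>A function of \<open>X\<close> carries no more information than \<open>X\<close>. Applied in both directions, this also
  identifies the entropies of two variables that determine each other.\<close>

lemma shannon_function_le:
  assumes X: "simple_function M X" and Y: "\<And>x. x \<in> space M \<Longrightarrow> Y x = f (X x)"
  shows "shannon M Y \<le> shannon M X"
proof -
  interpret information_space M "exp 1"
    by unfold_locales simp
  have "shannon M Y = shannon M (f \<circ> X)"
    using Y by (intro shannon_cong) simp
  also have "\<dots> \<le> shannon M X"
    using entropy_data_processing[OF X, of f] X
    by (simp add: shannon_eq_entropy simple_function_compose)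
  finally show ?thesis .
qed

end

text \<open>The nonnegativity of conditional mutual information for arrays with finitely many entries: by
  \<open>ln r \<le> r - 1\<close>, the difference of the two sides is at most the sum of
  \<open>pxz * pyz / pz - p\<close>, and both terms of this sum have the same total mass. Terms with
  \<open>p = 0\<close> are harmless because \<open>0 * ln 0 = 0\<close>.\<close>

lemma submodular_sum:
  fixes p :: "'a \<Rightarrow> 'b \<Rightarrow> 'c \<Rightarrow> real"
  assumes fin: "finite A" "finite B" "finite C"
    and p0: "\<And>x y z. 0 \<le> p x y z"
    and xz: "\<And>x z. x \<in> A \<Longrightarrow> z \<in> C \<Longrightarrow> pxz x z = (\<Sum>y\<in>B. p x y z)"
    and yz: "\<And>y z. y \<in> B \<Longrightarrow> z \<in> C \<Longrightarrow> pyz y z = (\<Sum>x\<in>A. p x y z)"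
    and z: "\<And>z. z \<in> C \<Longrightarrow> pz z = (\<Sum>x\<in>A. \<Sum>y\<in>B. p x y z)"
  shows "(\<Sum>x\<in>A. \<Sum>z\<in>C. pxz x z * ln (pxz x z)) + (\<Sum>y\<in>B. \<Sum>z\<in>C. pyz y z * ln (pyz y z))
    \<le> (\<Sum>x\<in>A. \<Sum>y\<in>B. \<Sum>z\<in>C. p x y z * ln (p x y z)) + (\<Sum>z\<in>C. pz z * ln (pz z))"
proof -
  have e1: "(\<Sum>x\<in>A. \<Sum>z\<in>C. pxz x z * ln (pxz x z)) =
      (\<Sum>z\<in>C. \<Sum>x\<in>A. \<Sum>y\<in>B. p x y z * ln (pxz x z))"
    by (subst sum.swap) (auto simp: xz sum_distrib_right intro!: sum.cong)
  have "(\<Sum>y\<in>B. \<Sum>z\<in>C. pyz y z * ln (pyz y z)) =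
      (\<Sum>y\<in>B. \<Sum>z\<in>C. \<Sum>x\<in>A. p x y z * ln (pyz y z))"
    by (auto simp: yz sum_distrib_right intro!: sum.cong)
  also have "\<dots> = (\<Sum>z\<in>C. \<Sum>y\<in>B. \<Sum>x\<in>A. p x y z * ln (pyz y z))"
    by (rule sum.swap)
  also have "\<dots> = (\<Sum>z\<in>C. \<Sum>x\<in>A. \<Sum>y\<in>B. p x y z * ln (pyz y z))"
    by (intro sum.cong refl sum.swap)
  finally have e2: "(\<Sum>y\<in>B. \<Sum>z\<in>C. pyz y z * ln (pyz y z)) =
      (\<Sum>z\<in>C. \<Sum>x\<in>A. \<Sum>y\<in>B. p x y z * ln (pyz y z))" .
  have e3: "(\<Sum>z\<in>C. pz z * ln (pz z)) = (\<Sum>z\<in>C. \<Sum>x\<in>A. \<Sum>y\<in>B. p x y z * ln (pz z))"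
    by (auto simp: z sum_distrib_right intro!: sum.cong)
  have "(\<Sum>x\<in>A. \<Sum>y\<in>B. \<Sum>z\<in>C. p x y z * ln (p x y z)) =
      (\<Sum>x\<in>A. \<Sum>z\<in>C. \<Sum>y\<in>B. p x y z * ln (p x y z))"
    by (intro sum.cong refl sum.swap)
  also have "\<dots> = (\<Sum>z\<in>C. \<Sum>x\<in>A. \<Sum>y\<in>B. p x y z * ln (p x y z))"
    by (rule sum.swap)
  finally have e4: "(\<Sum>x\<in>A. \<Sum>y\<in>B. \<Sum>z\<in>C. p x y z * ln (p x y z)) =
      (\<Sum>z\<in>C. \<Sum>x\<in>A. \<Sum>y\<in>B. p x y z * ln (p x y z))" .
  have main: "p x y z * ln (pxz x z) + p x y z * ln (pyz y z) - p x y z * ln (p x y z)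
      - p x y z * ln (pz z) \<le> pxz x z * pyz y z / pz z - p x y z"
    if "x \<in> A" "y \<in> B" "z \<in> C" for x y z
  proof (cases "p x y z = 0")
    case True
    have "0 \<le> pxz x z" "0 \<le> pyz y z" "0 \<le> pz z"
      using that p0 by (auto simp: xz yz z intro!: sum_nonneg)
    with True show ?thesis by simp
  next
    case False
    then have p: "0 < p x y z"
      using p0[of x y z] by linarith
    have a: "p x y z \<le> pxz x z" "p x y z \<le> pyz y z"
      using that p0 fin by (auto simp: xz yz intro!: member_le_sum)
    have "pxz x z \<le> pz z"
      using that p0 fin by (auto simp: xz z intro!: member_le_sum sum_nonneg)
    with a p have pos: "0 < pxz x z" "0 < pyz y z" "0 < pz z"
      by auto
    have "ln (pxz x z * pyz y z / (p x y z * pz z)) \<le> pxz x z * pyz y z / (p x y z * pz z) - 1"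
      using pos p by (intro ln_le_minus_one) auto
    then have "p x y z * ln (pxz x z * pyz y z / (p x y z * pz z))
        \<le> p x y z * (pxz x z * pyz y z / (p x y z * pz z) - 1)"
      using p by (intro mult_left_mono) auto
    also have "\<dots> = pxz x z * pyz y z / pz z - p x y z"
      using p pos by (simp add: field_simps)
    finally show ?thesis
      using p pos by (simp add: ln_div ln_mult algebra_simps)
  qed
  have "(\<Sum>x\<in>A. \<Sum>y\<in>B. pxz x z * pyz y z / pz z - p x y z) \<le> 0" if "z \<in> C" for z
  proof -
    have s: "(\<Sum>x\<in>A. pxz x z) = pz z" "(\<Sum>y\<in>B. pyz y z) = pz z"
      using that by (auto simp: xz yz z) (subst sum.swap, simp)
    have "(\<Sum>x\<in>A. \<Sum>y\<in>B. pxz x z * pyz y z / pz z) = (\<Sum>x\<in>A. pxz x z) * (\<Sum>y\<in>B. pyz y z) / pz z"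
      by (simp add: sum_product sum_divide_distrib)
    then show ?thesis
      using s that by (simp add: sum_subtractf z[symmetric])
  qed
  then have "(\<Sum>z\<in>C. \<Sum>x\<in>A. \<Sum>y\<in>B. pxz x z * pyz y z / pz z - p x y z) \<le> 0"
    by (rule sum_nonpos)
  moreover have "(\<Sum>z\<in>C. \<Sum>x\<in>A. \<Sum>y\<in>B. p x y z * ln (pxz x z) + p x y z * ln (pyz y z)
      - p x y z * ln (p x y z) - p x y z * ln (pz z))
      \<le> (\<Sum>z\<in>C. \<Sum>x\<in>A. \<Sum>y\<in>B. pxz x z * pyz y z / pz z - p x y z)"
    using main by (intro sum_mono) auto
  ultimately show ?thesis
    unfolding e1 e2 e3 e4 by (simp add: sum.distrib sum_subtractf)
qed

context prob_space
begin

lemma measure_fibre_sum: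
  assumes X: "simple_function M X" and B: "B \<in> sets M"
  shows "measure M B = (\<Sum>v\<in>X ` space M. measure M (B \<inter> (X -` {v} \<inter> space M)))"
proof -
  have fin: "finite (X ` space M)" and m: "\<And>v. X -` {v} \<inter> space M \<in> sets M"
    using X by (auto simp: simple_functionD)
  have "measure M (\<Union>v\<in>X ` space M. B \<inter> (X -` {v} \<inter> space M)) =
      (\<Sum>v\<in>X ` space M. measure M (B \<inter> (X -` {v} \<inter> space M)))"
    using fin m B by (intro finite_measure_finite_Union) (auto simp: disjoint_family_on_def)
  moreover have "(\<Union>v\<in>X ` space M. B \<inter> (X -` {v} \<inter> space M)) = B"
    using sets.sets_into_space[OF B] by auto
  ultimately show ?thesis
    by simp
qed

lemma shannon_submodular:
  assumes X: "simple_function M X" and Y: "simple_function M Y" and Z: "simple_function M Z"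
  shows "shannon M (\<lambda>x. (X x, Y x, Z x)) + shannon M Z
    \<le> shannon M (\<lambda>x. (X x, Z x)) + shannon M (\<lambda>x. (Y x, Z x))"
proof -
  let ?A = "X ` space M" and ?B = "Y ` space M" and ?C = "Z ` space M"
  have fin: "finite ?A" "finite ?B" "finite ?C"
    using X Y Z by (auto simp: simple_functionD)
  define p where "p a b c = measure M ((\<lambda>x. (X x, Y x, Z x)) -` {(a, b, c)} \<inter> space M)" for a b c
  define pxz where "pxz a c = measure M ((\<lambda>x. (X x, Z x)) -` {(a, c)} \<inter> space M)" for a c
  define pyz where "pyz b c = measure M ((\<lambda>x. (Y x, Z x)) -` {(b, c)} \<inter> space M)" for b c
  define pz where "pz c = measure M (Z -` {c} \<inter> space M)" for c
  have mX: "X -` {v} \<inter> space M \<in> sets M" and mY: "Y -` {w} \<inter> space M \<in> sets M"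
    and mZ: "Z -` {u} \<inter> space M \<in> sets M" for v w u
    using X Y Z by (auto simp: simple_functionD)
  have sXZ: "(\<lambda>x. (X x, Z x)) -` {(a, c)} \<inter> space M
      = (X -` {a} \<inter> space M) \<inter> (Z -` {c} \<inter> space M)" for a c
    by auto
  have sYZ: "(\<lambda>x. (Y x, Z x)) -` {(b, c)} \<inter> space M
      = (Y -` {b} \<inter> space M) \<inter> (Z -` {c} \<inter> space M)" for b c
    by auto
  have p1: "measure M ((X -` {a} \<inter> space M) \<inter> (Z -` {c} \<inter> space M) \<inter> (Y -` {b} \<inter> space M)) = p a b c"
    for a b c
    unfolding p_def by (rule arg_cong[where f = "measure M"]) auto
  have p2: "measure M ((Y -` {b} \<inter> space M) \<inter> (Z -` {c} \<inter> space M) \<inter> (X -` {a} \<inter> space M)) = p a b c"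
    for a b c
    unfolding p_def by (rule arg_cong[where f = "measure M"]) auto
  have H1: "pxz a c = (\<Sum>b\<in>?B. p a b c)" for a c
    unfolding pxz_def sXZ measure_fibre_sum[OF Y sets.Int[OF mX mZ]] p1 ..
  have H2: "pyz b c = (\<Sum>a\<in>?A. p a b c)" for b c
    unfolding pyz_def sYZ measure_fibre_sum[OF X sets.Int[OF mY mZ]] p2 ..
  have p3: "measure M ((Z -` {c} \<inter> space M) \<inter> (X -` {a} \<inter> space M)) = pxz a c" for a c
    unfolding pxz_def by (rule arg_cong[where f = "measure M"]) auto
  have H3: "pz c = (\<Sum>a\<in>?A. pxz a c)" for c
    unfolding pz_def measure_fibre_sum[OF X mZ] p3 ..
  have S1: "shannon M (\<lambda>x. (X x, Y x, Z x)) = - (\<Sum>a\<in>?A. \<Sum>b\<in>?B. \<Sum>c\<in>?C. p a b c * ln (p a b c))"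
    by (subst shannon_superset[of "?A \<times> ?B \<times> ?C"])
      (use fin in \<open>auto simp: sum.cartesian_product p_def split_beta\<close>)
  have S2: "shannon M (\<lambda>x. (X x, Z x)) = - (\<Sum>a\<in>?A. \<Sum>c\<in>?C. pxz a c * ln (pxz a c))"
    by (subst shannon_superset[of "?A \<times> ?C"])
      (use fin in \<open>auto simp: sum.cartesian_product pxz_def split_beta\<close>)
  have S3: "shannon M (\<lambda>x. (Y x, Z x)) = - (\<Sum>b\<in>?B. \<Sum>c\<in>?C. pyz b c * ln (pyz b c))"
    by (subst shannon_superset[of "?B \<times> ?C"])
      (use fin in \<open>auto simp: sum.cartesian_product pyz_def split_beta\<close>)
  have S4: "shannon M Z = - (\<Sum>c\<in>?C. pz c * ln (pz c))"
    by (simp add: shannon_def pz_def)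
  have "(\<Sum>a\<in>?A. \<Sum>c\<in>?C. pxz a c * ln (pxz a c)) + (\<Sum>b\<in>?B. \<Sum>c\<in>?C. pyz b c * ln (pyz b c))
    \<le> (\<Sum>a\<in>?A. \<Sum>b\<in>?B. \<Sum>c\<in>?C. p a b c * ln (p a b c)) + (\<Sum>c\<in>?C. pz c * ln (pz c))"
    by (rule submodular_sum) (auto simp: p_def[of _ _ _] fin H1 H2 H3)
  then show ?thesis
    unfolding S1 S2 S3 S4 by linarith
qed

lemma shannon_pair_le:
  assumes X: "simple_function M X" and Y: "simple_function M Y"
  shows "shannon M (\<lambda>x. (X x, Y x)) \<le> shannon M X + shannon M Y"
proof -
  have U: "simple_function M (\<lambda>x. ())"
    by (simp add: simple_function_def)
  have XY: "simple_function M (\<lambda>x. (X x, Y x, ()))" "simple_function M (\<lambda>x. (X x, Y x))"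
    using X Y U by (intro simple_function_Pair; simp)+
  have "shannon M (\<lambda>x. (X x, Y x)) \<le> shannon M (\<lambda>x. (X x, Y x, ()))"
    by (rule shannon_function_le[OF XY(1), of _ "\<lambda>(a, b, c). (a, b)"]) simp
  also have "\<dots> \<le> shannon M (\<lambda>x. (X x, ())) + shannon M (\<lambda>x. (Y x, ()))"
    using shannon_submodular[OF X Y U] shannon_nonneg[of "\<lambda>x. ()"] by linarith
  also have "shannon M (\<lambda>x. (X x, ())) \<le> shannon M X"
    by (rule shannon_function_le[OF X, of _ "\<lambda>a. (a, ())"]) simp
  also have "shannon M (\<lambda>x. (Y x, ())) \<le> shannon M Y"
    by (rule shannon_function_le[OF Y, of _ "\<lambda>a. (a, ())"]) simp
  finally show ?thesis by simp
qed

end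

section \<open>Entropy of a measure-preserving map\<close>

text \<open>The variable \<open>X\<close> observed at the times \<open>0, \<dots>, n - 1\<close>; its level sets form the \<open>n\<close>-fold join of the
  level sets of \<open>X\<close>.\<close>

definition itinerary :: "('a \<Rightarrow> 'a) \<Rightarrow> ('a \<Rightarrow> 'b) \<Rightarrow> nat \<Rightarrow> 'a \<Rightarrow> 'b list" where
  "itinerary T X n x = map (\<lambda>i. X ((T ^^ i) x)) [0..<n]"

lemma length_itinerary [simp]: "length (itinerary T X n x) = n"
  by (simp add: itinerary_def)

lemma itinerary_Suc: "itinerary T X (Suc n) x = itinerary T X n x @ [X ((T ^^ n) x)]"
  by (simp add: itinerary_def)

lemma itinerary_add: "itinerary T X (m + n) x = itinerary T X m x @ itinerary T X n ((T ^^ m) x)"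
proof (induction n)
  case (Suc n)
  have "(T ^^ (m + n)) x = (T ^^ n) ((T ^^ m) x)"
    by (subst add.commute) (simp add: funpow_add)
  then show ?case
    using Suc by (simp add: itinerary_Suc)
qed (simp add: itinerary_def)

definition fibres :: "'a measure \<Rightarrow> ('a \<Rightarrow> 'b) \<Rightarrow> 'a set set" where
  "fibres M X = (\<lambda>v. X -` {v} \<inter> space M) ` (X ` space M)"

lemma partition_entropy_fibres: "partition_entropy M (fibres M X) = shannon M X"
proof -
  have "inj_on (\<lambda>v. X -` {v} \<inter> space M) (X ` space M)"
    by (rule inj_onI) auto
  then show ?thesis
    by (simp add: partition_entropy_def fibres_def shannon_def sum.reindex)
qed

text \<open>An element of the refinement picks one cell for each time, and is determined by any of its
  points. For \<open>n = 0\<close> the refinement of the empty family is \<open>{UNIV}\<close>, hence the restriction on \<open>n\<close>.\<close>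

lemma iterated_join_fibres:
  assumes T: "T \<in> space M \<rightarrow> space M" and n: "n > 0"
  shows "iterated_join M T (fibres M X) n = fibres M (itinerary T X n)"
proof -
  define F where "F i = preimage_partition M (T ^^ i) (fibres M X)" for i
  define cell where "cell i x = {y \<in> space M. X ((T ^^ i) y) = X ((T ^^ i) x)}" for i x
  have Tn: "(T ^^ i) x \<in> space M" if "x \<in> space M" for i x
    using T that by (induction i) auto
  have F_eq: "q = cell i x" if "q \<in> F i" "x \<in> q" for q i x
    using that Tn by (auto simp: F_def preimage_partition_def fibres_def cell_def)
  have cell_in: "cell i x \<in> F i" if "x \<in> space M" for i x
  proof -
    have "(T ^^ i) -` (X -` {X ((T ^^ i) x)} \<inter> space M) \<inter> space M = cell i x"
      using Tn by (auto simp: cell_def)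
    then show ?thesis
      unfolding F_def preimage_partition_def fibres_def using Tn[OF that, of i] by blast
  qed
  have fibre: "itinerary T X n -` {itinerary T X n x} \<inter> space M = (\<Inter>i\<in>{..<n}. cell i x)" for x
    using n by (auto simp: itinerary_def cell_def)
  have "common_refinement (F ` {..<n}) \<subseteq> fibres M (itinerary T X n)"
  proof
    fix q assume "q \<in> common_refinement (F ` {..<n})"
    then obtain f x where f: "f \<in> (\<Pi> Q\<in>F ` {..<n}. Q)" and q: "q = \<Inter> (f ` F ` {..<n})"
      and x: "x \<in> q"
      by (auto simp: common_refinement)
    have "f (F i) = cell i x" if "i < n" for i
      using f x q that by (intro F_eq) auto
    then have q': "q = (\<Inter>i\<in>{..<n}. cell i x)"
      using q by (simp add: image_image)
    moreover have "x \<in> space M"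
      using x n unfolding q' by (auto simp: cell_def)
    ultimately show "q \<in> fibres M (itinerary T X n)"
      unfolding fibres_def using fibre by blast
  qed
  moreover have "fibres M (itinerary T X n) \<subseteq> common_refinement (F ` {..<n})"
  proof
    fix q assume "q \<in> fibres M (itinerary T X n)"
    then obtain x where x: "x \<in> space M" and q': "q = itinerary T X n -` {itinerary T X n x} \<inter> space M"
      unfolding fibres_def by blast
    have q: "q = (\<Inter>i\<in>{..<n}. cell i x)"
      using q' fibre[of x] by (rule trans)
    define f where "f Q = (SOME p. p \<in> Q \<and> x \<in> p)" for Q :: "'a set set"
    have "cell i x \<in> F i \<and> x \<in> cell i x" for i
      using cell_in[OF x, of i] x by (auto simp: cell_def)
    then have *: "f (F i) \<in> F i \<and> x \<in> f (F i)" for i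
      unfolding f_def by (rule someI)
    then have "f (F i) = cell i x" for i
      using F_eq by blast
    then have "q = \<Inter> (f ` F ` {..<n})"
      using q by (simp add: image_image)
    moreover have "x \<in> q"
      using x q by (auto simp: cell_def)
    moreover have "f \<in> (\<Pi> Q\<in>F ` {..<n}. Q)"
      using * by auto
    ultimately show "q \<in> common_refinement (F ` {..<n})"
      unfolding common_refinement by blast
  qed
  ultimately show ?thesis
    unfolding iterated_join_def F_def by blast
qed

lemma measurable_partition_fibres:
  assumes "simple_function M X"
  shows "measurable_partition M (fibres M X)"
  using assms
  by (auto simp: measurable_partition_def fibres_def partition_on_def disjoint_def
      simple_functionD)

text \<open>The label of a point is the partition element that contains it, so every finite measurable
  partition comes from a random variable.\<close>

lemma measurable_partition_obtains_label:
  assumes P: "measurable_partition M P"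
  obtains c :: "'a \<Rightarrow> 'a set" where "simple_function M c" "fibres M c = P"
proof -
  have part: "\<Union>P = space M" "disjoint P" "{} \<notin> P" and fin: "finite P" and PM: "P \<subseteq> sets M"
    using P by (auto simp: measurable_partition_def partition_on_def)
  define c where "c x = (THE p. p \<in> P \<and> x \<in> p)" for x
  have c: "c x = p" if "p \<in> P" "x \<in> p" for p x
    unfolding c_def using that part(2) by (intro the_equality) (auto simp: disjoint_def)
  have c_in: "x \<in> c x \<and> c x \<in> P" if "x \<in> space M" for x
  proof -
    obtain p where "p \<in> P" "x \<in> p"
      using \<open>x \<in> space M\<close> part(1) by auto
    with c[of p x] show ?thesis
      by simp
  qed
  have im: "c ` space M = P"
  proof
    show "c ` space M \<subseteq> P"
      using c_in by blast
    show "P \<subseteq> c ` space M"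
    proof
      fix p assume p: "p \<in> P"
      then obtain x where "x \<in> p"
        using part(3) by (cases "p = {}") auto
      then show "p \<in> c ` space M"
        using p c part(1) by (intro image_eqI[of _ _ x]) auto
    qed
  qed
  have fib: "c -` {p} \<inter> space M = p" if "p \<in> P" for p
    using that c c_in part(1) by blast
  show thesis
  proof (rule that)
    show "simple_function M c"
      unfolding simple_function_def im using fin fib PM by auto
    show "fibres M c = P"
      unfolding fibres_def im using fib by simp
  qed
qed

locale measure_preserving = prob_space M for M :: "'a measure" +
  fixes T :: "'a \<Rightarrow> 'a"
  assumes T_measurable [measurable]: "T \<in> measurable M M"
    and T_invariant: "distr M M T = M"
begin

lemma measure_preserving_funpow: "measure_preserving M (T ^^ n)"
proof (induction n)
  case 0
  show ?case
    by unfold_locales (auto simp: distr_id)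
next
  case (Suc n)
  interpret Tn: measure_preserving M "T ^^ n" by (rule Suc)
  have "distr M M (T \<circ> (T ^^ n)) = distr (distr M M (T ^^ n)) M T"
    by (subst distr_distr) auto
  then show ?case
    by unfold_locales (auto simp: Tn.T_invariant T_invariant simp del: comp_apply)
qed

lemma measure_vimage:
  assumes "B \<in> sets M"
  shows "measure M (T -` B \<inter> space M) = measure M B"
  using measure_distr[OF T_measurable assms] by (simp add: T_invariant)

lemma shannon_comp:
  assumes X: "simple_function M X"
  shows "shannon M (\<lambda>x. X (T x)) = shannon M X"
proof -
  have "(\<lambda>x. X (T x)) ` space M \<subseteq> X ` space M"
    using measurable_space[OF T_measurable] by auto
  moreover have "measure M ((\<lambda>x. X (T x)) -` {v} \<inter> space M) = measure M (X -` {v} \<inter> space M)" for v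
  proof -
    have "(\<lambda>x. X (T x)) -` {v} \<inter> space M = T -` (X -` {v} \<inter> space M) \<inter> space M"
      using measurable_space[OF T_measurable] by auto
    then show ?thesis
      using measure_vimage[OF simple_functionD(2)[OF X, of "{v}"]] by simp
  qed
  ultimately show ?thesis
    using simple_functionD(1)[OF X] by (subst shannon_superset[of "X ` space M"])
      (auto simp: shannon_def)
qed

lemma simple_function_comp_T: "simple_function M X \<Longrightarrow> simple_function M (\<lambda>x. X ((T ^^ i) x))"
  using measure_preserving.T_measurable[OF measure_preserving_funpow]
  by (rule simple_function_comp)

lemma simple_function_itinerary:
  assumes X: "simple_function M X"
  shows "simple_function M (itinerary T X n)"
proof (induction n)
  case 0
  then show ?case by (simp add: itinerary_def[abs_def])
next
  case (Suc n)
  then show ?case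
    unfolding itinerary_Suc
    by (intro simple_function_compose2[where h = "\<lambda>a b. a @ [b]"] simple_function_comp_T X)
qed

lemma shannon_funpow:
  "simple_function M X \<Longrightarrow> shannon M (\<lambda>x. X ((T ^^ i) x)) = shannon M X"
  by (rule measure_preserving.shannon_comp[OF measure_preserving_funpow])

lemma shannon_itinerary_subadditive:
  assumes X: "simple_function M X"
  shows "shannon M (itinerary T X (m + n))
    \<le> shannon M (itinerary T X m) + shannon M (itinerary T X n)"
proof -
  note S = simple_function_itinerary[OF X]
  note S' = simple_function_comp_T[OF S[of n], of m]
  have "shannon M (itinerary T X (m + n))
      \<le> shannon M (\<lambda>x. (itinerary T X m x, itinerary T X n ((T ^^ m) x)))"
    by (rule shannon_function_le[OF simple_function_Pair[OF S S'], of _ "\<lambda>(a, b). a @ b"])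
      (simp add: itinerary_add)
  also have "\<dots> \<le> shannon M (itinerary T X m) + shannon M (\<lambda>x. itinerary T X n ((T ^^ m) x))"
    by (rule shannon_pair_le[OF S S'])
  also have "shannon M (\<lambda>x. itinerary T X n ((T ^^ m) x)) = shannon M (itinerary T X n)"
    by (rule shannon_funpow[OF S])
  finally show ?thesis .
qed

definition entropy_rate :: "('a \<Rightarrow> 'b) \<Rightarrow> real" where
  "entropy_rate X = lim (\<lambda>n. shannon M (itinerary T X n) / real n)"

lemma entropy_rate_tendsto:
  assumes X: "simple_function M X"
  shows "(\<lambda>n. shannon M (itinerary T X n) / real n) \<longlonglongrightarrow> entropy_rate X"
proof -
  have "- 0 * real n \<le> shannon M (itinerary T X n)" for n
    using shannon_nonneg by simp
  then obtain L where "(\<lambda>n. shannon M (itinerary T X n) / real n) \<longlonglongrightarrow> L"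
    using fekete_real[OF shannon_itinerary_subadditive[OF X], of 0] by blast
  then show ?thesis
    unfolding entropy_rate_def by (simp add: limI)
qed

lemma entropy_wrt_partition_fibres:
  assumes X: "simple_function M X"
  shows "entropy_wrt_partition M T (fibres M X) = entropy_rate X"
proof -
  have "T \<in> space M \<rightarrow> space M"
    using measurable_space[OF T_measurable] by auto
  then have "eventually (\<lambda>n. shannon M (itinerary T X n) / real n =
      (1 / real n) * partition_entropy M (iterated_join M T (fibres M X) n)) sequentially"
    by (intro eventually_mono[OF eventually_gt_at_top[of 0]])
      (simp add: iterated_join_fibres partition_entropy_fibres)
  then have "(\<lambda>n. (1 / real n) * partition_entropy M (iterated_join M T (fibres M X) n))
      \<longlonglongrightarrow> entropy_rate X"
    using entropy_rate_tendsto[OF X] by (rule tendsto_cong[THEN iffD1])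
  then show ?thesis
    unfolding entropy_wrt_partition_def by (rule limI)
qed

text \<open>Each time step adds at most the conditional entropy of \<open>X\<close> given \<open>Y\<close> to the entropy of the
  \<open>X\<close>-itinerary given the \<open>Y\<close>-itinerary: conditioning on more variables decreases entropy, which is
  three applications of submodularity.\<close>

lemma shannon_itinerary_joint_le:
  assumes X: "simple_function M X" and Y: "simple_function M Y"
  shows "shannon M (\<lambda>x. (itinerary T X n x, itinerary T Y n x))
    \<le> shannon M (itinerary T Y n) + real n * (shannon M (\<lambda>x. (X x, Y x)) - shannon M Y)"
proof (induction n)
  case 0
  have "shannon M (\<lambda>x. (itinerary T X 0 x, itinerary T Y 0 x)) \<le> shannon M (itinerary T Y 0)"
    by (rule shannon_function_le[OF simple_function_itinerary[OF Y], of _ "\<lambda>a. ([], a)"])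
      (simp add: itinerary_def)
  then show ?case
    by simp
next
  case (Suc n)
  let ?C = "itinerary T X n" and ?D = "itinerary T Y n"
  let ?c = "\<lambda>x. X ((T ^^ n) x)" and ?d = "\<lambda>x. Y ((T ^^ n) x)"
  note S = simple_function_itinerary[OF X, of n] simple_function_itinerary[OF Y, of n]
    simple_function_comp_T[OF X, of n] simple_function_comp_T[OF Y, of n]
  note SP = S simple_function_Pair
  have eq: "shannon M U = shannon M V" if "simple_function M U" "simple_function M V"
    "\<And>x. U x = f (V x)" "\<And>x. V x = g (U x)" for f g and U :: "'a \<Rightarrow> 'u" and V :: "'a \<Rightarrow> 'v"
    using that by (intro antisym shannon_function_le[of _ _ f] shannon_function_le[of _ _ g]) auto
  have 1: "shannon M (\<lambda>x. ((?C x, ?c x), ?D x, ?d x)) + shannon M (\<lambda>x. (?D x, ?d x))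
      \<le> shannon M (\<lambda>x. (?C x, ?D x, ?d x)) + shannon M (\<lambda>x. (?c x, ?D x, ?d x))"
  proof -
    have "shannon M (\<lambda>x. ((?C x, ?c x), ?D x, ?d x)) = shannon M (\<lambda>x. (?C x, ?c x, ?D x, ?d x))"
      by (rule eq[of _ _ "\<lambda>(a, b, c). ((a, b), c)" "\<lambda>((a, b), c). (a, b, c)"])
        (intro SP | simp)+
    then show ?thesis
      using shannon_submodular[OF S(1) S(3) simple_function_Pair[OF S(2) S(4)]] by simp
  qed
  have 2: "shannon M (\<lambda>x. (?C x, ?D x, ?d x)) + shannon M ?D
      \<le> shannon M (\<lambda>x. (?C x, ?D x)) + shannon M (\<lambda>x. (?D x, ?d x))"
  proof -
    have "shannon M (\<lambda>x. (?C x, ?D x, ?d x)) = shannon M (\<lambda>x. (?C x, ?d x, ?D x))"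
      by (rule eq[of _ _ "\<lambda>(a, b, c). (a, c, b)" "\<lambda>(a, b, c). (a, c, b)"])
        (intro SP | simp)+
    moreover have "shannon M (\<lambda>x. (?D x, ?d x)) = shannon M (\<lambda>x. (?d x, ?D x))"
      by (rule eq[of _ _ "\<lambda>(a, b). (b, a)" "\<lambda>(a, b). (b, a)"])
        (intro SP | simp)+
    ultimately show ?thesis
      using shannon_submodular[OF S(1) S(4) S(2)] by simp
  qed
  have 3: "shannon M (\<lambda>x. (?c x, ?D x, ?d x)) + shannon M ?d
      \<le> shannon M (\<lambda>x. (?c x, ?d x)) + shannon M (\<lambda>x. (?D x, ?d x))"
    by (rule shannon_submodular[OF S(3) S(2) S(4)])
  have 4: "shannon M ?d = shannon M Y" "shannon M (\<lambda>x. (?c x, ?d x)) = shannon M (\<lambda>x. (X x, Y x))"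
    using shannon_funpow[OF Y, of n] shannon_funpow[OF simple_function_Pair[OF X Y], of n] by auto
  have 5: "shannon M (\<lambda>x. (itinerary T X (Suc n) x, itinerary T Y (Suc n) x))
      \<le> shannon M (\<lambda>x. ((?C x, ?c x), ?D x, ?d x))"
    by (rule shannon_function_le[of _ _ "\<lambda>((a, b), c, d). (a @ [b], c @ [d])"])
      (intro SP | simp add: itinerary_Suc)+
  have 6: "shannon M (\<lambda>x. (?D x, ?d x)) \<le> shannon M (itinerary T Y (Suc n))"
    by (rule shannon_function_le[OF simple_function_itinerary[OF Y], of _ "\<lambda>l. (butlast l, last l)"])
      (simp add: itinerary_Suc)
  show ?case
    using Suc 1 2 3 4 5 6 by (simp add: algebra_simps)
qed

lemma entropy_rate_le:
  assumes X: "simple_function M X" and Y: "simple_function M Y"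
  shows "entropy_rate X \<le> entropy_rate Y + (shannon M (\<lambda>x. (X x, Y x)) - shannon M Y)"
proof (rule LIMSEQ_le[OF entropy_rate_tendsto[OF X]])
  let ?e = "shannon M (\<lambda>x. (X x, Y x)) - shannon M Y"
  show "(\<lambda>n. shannon M (itinerary T Y n) / real n + ?e) \<longlonglongrightarrow> entropy_rate Y + ?e"
    by (intro tendsto_add tendsto_const entropy_rate_tendsto[OF Y])
  have "shannon M (itinerary T X n) / real n \<le> shannon M (itinerary T Y n) / real n + ?e"
    if "n \<ge> 1" for n
  proof -
    have "shannon M (itinerary T X n) \<le> shannon M (\<lambda>x. (itinerary T X n x, itinerary T Y n x))"
      by (rule shannon_function_le[of _ _ fst])
        (auto intro!: simple_function_Pair simple_function_itinerary X Y)
    also have "\<dots> \<le> shannon M (itinerary T Y n) + real n * ?e"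
      by (rule shannon_itinerary_joint_le[OF X Y])
    finally show ?thesis
      using that by (simp add: field_simps)
  qed
  then show "\<exists>N. \<forall>n\<ge>N. shannon M (itinerary T X n) / real n
      \<le> shannon M (itinerary T Y n) / real n + ?e"
    by blast
qed

lemma entropy_rate_itinerary_le:
  assumes X: "simple_function M X"
  shows "entropy_rate (itinerary T X k) \<le> entropy_rate X"
proof (rule LIMSEQ_le[OF entropy_rate_tendsto])
  show "simple_function M (itinerary T X k)"
    by (rule simple_function_itinerary[OF X])
  have "(\<lambda>n. shannon M (itinerary T X n) / real n + shannon M (itinerary T X k) / real n)
      \<longlonglongrightarrow> entropy_rate X + 0"
    by (intro tendsto_add entropy_rate_tendsto[OF X] lim_const_over_n)
  then show "(\<lambda>n. shannon M (itinerary T X n) / real n + shannon M (itinerary T X k) / real n)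
      \<longlonglongrightarrow> entropy_rate X"
    by simp
  have "shannon M (itinerary T (itinerary T X k) n)
      \<le> shannon M (itinerary T X n) + shannon M (itinerary T X k)" for n
  proof -
    have "shannon M (itinerary T (itinerary T X k) n) \<le> shannon M (itinerary T X (n + k))"
    proof (rule shannon_function_le[OF simple_function_itinerary[OF X],
          of _ "\<lambda>l. map (\<lambda>i. take k (drop i l)) [0..<n]"])
      fix x
      have "itinerary T X k ((T ^^ i) x) = take k (drop i (itinerary T X (n + k) x))" if "i < n" for i
      proof -
        have "itinerary T X (i + (k + (n - i))) x = itinerary T X i x
            @ itinerary T X k ((T ^^ i) x) @ itinerary T X (n - i) ((T ^^ k) ((T ^^ i) x))"
          by (simp add: itinerary_add)
        moreover have "i + (k + (n - i)) = n + k"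
          using that by simp
        ultimately have "itinerary T X (n + k) x = itinerary T X i x
            @ itinerary T X k ((T ^^ i) x) @ itinerary T X (n - i) ((T ^^ k) ((T ^^ i) x))"
          by (simp only:)
        then show ?thesis
          by simp
      qed
      then show "itinerary T (itinerary T X k) n x
          = map (\<lambda>i. take k (drop i (itinerary T X (n + k) x))) [0..<n]"
        by (simp add: itinerary_def[of T "itinerary T X k"])
    qed
    then show ?thesis
      using shannon_itinerary_subadditive[OF X, of n k] by linarith
  qed
  then show "\<exists>N. \<forall>n\<ge>N. shannon M (itinerary T (itinerary T X k) n) / real n
      \<le> shannon M (itinerary T X n) / real n + shannon M (itinerary T X k) / real n"
    by (auto simp: divide_right_mono simp flip: add_divide_distrib)
qed

text \<open>The Kolmogorov--Sinai theorem for a generating variable. The rate of a variable \<open>c\<close> exceeds that of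
  the itineraries of length \<open>k\<close> by at most the conditional entropy of \<open>c\<close> given such an itinerary, and
  the rate of these is at most that of \<open>X\<close>, because \<open>n\<close> consecutive ones are a function of one itinerary of
  length \<open>n + k\<close>.\<close>

lemma metric_entropy_generator:
  assumes X: "simple_function M X"
    and gen: "\<And>c e. simple_function M (c :: 'a \<Rightarrow> 'a set) \<Longrightarrow> 0 < e \<Longrightarrow>
      \<exists>k. shannon M (\<lambda>x. (c x, itinerary T X k x)) - shannon M (itinerary T X k) \<le> e"
  shows "metric_entropy M T = ereal (entropy_rate X)"
  unfolding metric_entropy_def
proof (rule antisym)
  show "(SUP P\<in>{P. measurable_partition M P}. ereal (entropy_wrt_partition M T P))
      \<le> ereal (entropy_rate X)"
  proof (rule SUP_least)
    fix P assume "P \<in> {P. measurable_partition M P}"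
    then obtain c :: "'a \<Rightarrow> 'a set" where c: "simple_function M c" "fibres M c = P"
      by (auto elim: measurable_partition_obtains_label)
    have "entropy_rate c \<le> entropy_rate X + e" if e: "0 < e" for e
    proof -
      obtain k where "shannon M (\<lambda>x. (c x, itinerary T X k x)) - shannon M (itinerary T X k) \<le> e"
        using gen[OF c(1) e] by blast
      then show ?thesis
        using entropy_rate_le[OF c(1) simple_function_itinerary[OF X], of k]
          entropy_rate_itinerary_le[OF X, of k] by linarith
    qed
    then have "entropy_rate c \<le> entropy_rate X"
      by (rule field_le_epsilon)
    then show "ereal (entropy_wrt_partition M T P) \<le> ereal (entropy_rate X)"
      using entropy_wrt_partition_fibres[OF c(1)] c(2) by simp
  qed
  show "ereal (entropy_rate X)
      \<le> (SUP P\<in>{P. measurable_partition M P}. ereal (entropy_wrt_partition M T P))"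
    using measurable_partition_fibres[OF X] entropy_wrt_partition_fibres[OF X]
    by (intro SUP_upper2[of "fibres M X"]) auto
qed

end

section \<open>Cylinders in the full shift\<close>

abbreviation shift_borel :: "(nat \<Rightarrow> 'm) measure" where
  "shift_borel \<equiv> borel_of_topology full_shift"

definition initial_word :: "nat \<Rightarrow> (nat \<Rightarrow> 'm) \<Rightarrow> 'm list" where
  "initial_word n x = map x [0..<n]"

definition cylinder :: "'m list \<Rightarrow> (nat \<Rightarrow> 'm) set" where
  "cylinder w = {x. initial_word (length w) x = w}"

definition words :: "nat \<Rightarrow> 'm list set" where
  "words n = {w. length w = n}"

lemma finite_words [simp]: "finite (words n :: 'm::finite list set)"
  unfolding words_def using finite_lists_length_eq[of "UNIV :: 'm set" n] by simp

lemma length_initial_word [simp]: "length (initial_word n x) = n"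
  by (simp add: initial_word_def)

lemma take_initial_word: "m \<le> n \<Longrightarrow> take m (initial_word n x) = initial_word m x"
  by (simp add: initial_word_def take_map)

lemma initial_word_Suc: "initial_word (Suc n) x = initial_word n x @ [x n]"
  by (simp add: initial_word_def)

lemma shift_funpow: "(shift ^^ n) x = (\<lambda>i. x (i + n))"
  by (induction n arbitrary: x) (auto simp: shift_def funpow_swap1)

lemma initial_word_add:
  "initial_word (m + n) x = initial_word m x @ initial_word n ((shift ^^ m) x)"
  by (rule nth_equalityI) (auto simp: initial_word_def nth_append shift_funpow)

lemma itinerary_shift: "itinerary shift (\<lambda>x. x 0) n = initial_word n"
  by (auto simp: itinerary_def initial_word_def shift_funpow fun_eq_iff)

lemma initial_word_image: "initial_word n ` UNIV = words n" (is "?L = ?R")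
proof
  show "?L \<subseteq> ?R"
    by (auto simp: words_def)
  show "?R \<subseteq> ?L"
  proof
    fix w assume w: "w \<in> ?R"
    have "w = initial_word n (\<lambda>i. w ! i)"
      using w by (intro nth_equalityI) (auto simp: words_def initial_word_def)
    then show "w \<in> ?L"
      by blast
  qed
qed

lemma mem_cylinder_iff: "x \<in> cylinder w \<longleftrightarrow> initial_word (length w) x = w"
  by (simp add: cylinder_def)

lemma mem_cylinder_nth: "x \<in> cylinder w \<longleftrightarrow> (\<forall>i<length w. x i = w ! i)"
proof -
  have "initial_word (length w) x = w \<longleftrightarrow> (\<forall>i<length w. initial_word (length w) x ! i = w ! i)"
    by (subst list_eq_iff_nth_eq) simp
  then show ?thesis
    unfolding mem_cylinder_iff by (simp add: initial_word_def)
qed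

lemma cylinder_Nil [simp]: "cylinder [] = UNIV"
  by (auto simp: cylinder_def initial_word_def)

lemma initial_word_vimage:
  "initial_word n -` {w} = (if length w = n then cylinder w else {})"
  by (auto simp: cylinder_def)

lemma openin_cylinder: "openin full_shift (cylinder w)"
proof -
  have "cylinder w = (\<Pi>\<^sub>E i\<in>UNIV. if i < length w then {w ! i} else UNIV)"
    by (auto simp: mem_cylinder_nth PiE_UNIV_domain Pi_iff split: if_splits)
  moreover have "finite {i. (if i < length w then {w ! i} else UNIV) \<noteq> UNIV}"
    by (rule finite_subset[of _ "{..<length w}"]) auto
  ultimately show ?thesis
    unfolding full_shift_def by (auto intro!: product_topology_basis)
qed

lemma open_contains_cylinder:
  assumes "openin full_shift U" "x \<in> U"
  obtains n where "cylinder (initial_word n x) \<subseteq> U"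
proof -
  obtain V where V: "finite {i. V i \<noteq> topspace (discrete_topology UNIV)}"
      "x \<in> Pi\<^sub>E UNIV V" "Pi\<^sub>E UNIV V \<subseteq> U"
    using assms unfolding full_shift_def openin_product_topology_alt by auto
  define n where "n = Suc (Max (insert 0 {i. V i \<noteq> UNIV}))"
  have n: "i < n" if "V i \<noteq> UNIV" for i
    unfolding n_def using V(1) that by (auto simp: less_Suc_eq_le intro!: Max_ge)
  have "cylinder (initial_word n x) \<subseteq> Pi\<^sub>E UNIV V"
  proof
    fix y assume y: "y \<in> cylinder (initial_word n x)"
    have "y i \<in> V i" for i
    proof (cases "V i = UNIV")
      case True
      then show ?thesis by (simp only: UNIV_I)
    next
      case False
      have "y i = x i"
        using y n[OF False] unfolding mem_cylinder_nth by (simp add: initial_word_def)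
      moreover have "x i \<in> V i"
        using V(2) unfolding PiE_UNIV_domain Pi_iff by blast
      ultimately show ?thesis by (simp only:)
    qed
    then show "y \<in> Pi\<^sub>E UNIV V"
      unfolding PiE_UNIV_domain Pi_iff by blast
  qed
  then show thesis
    using V(3) by (intro that) (rule subset_trans)
qed

lemma space_shift_borel [simp]: "space shift_borel = UNIV"
  by (simp add: borel_of_topology_def)

lemma sets_shift_borel:
  "sets (shift_borel :: (nat \<Rightarrow> 'm::finite) measure) = sigma_sets UNIV (range cylinder)"
proof -
  have "U \<in> sigma_sets UNIV (range cylinder)" if U: "openin full_shift U" for U :: "(nat \<Rightarrow> 'm) set"
  proof -
    have "U = (\<Union>w\<in>{w. cylinder w \<subseteq> U}. cylinder w)"
    proof
      show "U \<subseteq> (\<Union>w\<in>{w. cylinder w \<subseteq> U}. cylinder w)"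
      proof
        fix x assume "x \<in> U"
        then obtain n where "cylinder (initial_word n x) \<subseteq> U"
          by (rule open_contains_cylinder[OF U])
        then show "x \<in> (\<Union>w\<in>{w. cylinder w \<subseteq> U}. cylinder w)"
          by (auto simp: mem_cylinder_iff intro!: exI[of _ "initial_word n x"])
      qed
    qed auto
    moreover have "(\<Union>w\<in>{w. cylinder w \<subseteq> U}. cylinder w) \<in> sigma_sets UNIV (range cylinder)"
      by (rule sigma_sets_UNION) (auto intro!: countable_image)
    ultimately show ?thesis
      by metis
  qed
  then have "sigma_sets UNIV {U :: (nat \<Rightarrow> 'm) set. openin full_shift U}
      = sigma_sets UNIV (range cylinder)"
    by (intro sigma_sets_eqI) (auto intro: openin_cylinder)
  then show ?thesis
    by (simp add: borel_of_topology_def)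
qed

lemma cylinder_in_sets [measurable]: "cylinder w \<in> sets shift_borel"
  unfolding borel_of_topology_def
  by (simp add: sets_measure_of sigma_sets.Basic openin_cylinder)

lemma cylinder_Int:
  "cylinder v \<inter> cylinder w = {} \<or> cylinder v \<inter> cylinder w = cylinder v
    \<or> cylinder v \<inter> cylinder w = cylinder w"
proof -
  have *: "cylinder v \<inter> cylinder w = {} \<or> cylinder v \<inter> cylinder w = cylinder v"
    if "length w \<le> length v" for v w :: "'a list"
  proof (cases "take (length w) v = w")
    case True
    then have "x \<in> cylinder w" if "x \<in> cylinder v" for x
      using that True take_initial_word[OF \<open>length w \<le> length v\<close>, of x]
      unfolding mem_cylinder_iff by metis
    then show ?thesis by auto
  next
    case False
    then have "x \<notin> cylinder w" if "x \<in> cylinder v" for x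
      using that False take_initial_word[OF \<open>length w \<le> length v\<close>, of x]
      unfolding mem_cylinder_iff by metis
    then show ?thesis by auto
  qed
  show ?thesis
    using *[of w v] *[of v w] by (cases "length w \<le> length v") auto
qed

text \<open>Two cylinders are nested or disjoint, so they form a generator closed under intersection once
  the empty set is added.\<close>

lemma shift_measure_eqI:
  fixes \<nu> \<nu>' :: "(nat \<Rightarrow> 'm::finite) measure"
  assumes "sets \<nu> = sets shift_borel" "sets \<nu>' = sets shift_borel" "finite_measure \<nu>"
    and eq: "\<And>w. emeasure \<nu> (cylinder w) = emeasure \<nu>' (cylinder w)"
  shows "\<nu> = \<nu>'"
proof (rule measure_eqI_generator_eq)
  let ?E = "insert {} (range cylinder) :: (nat \<Rightarrow> 'm) set set"
  show "Int_stable ?E"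
    unfolding Int_stable_def
  proof (intro ballI)
    fix a b assume "a \<in> ?E" "b \<in> ?E"
    then consider "a \<inter> b = {}" | v w where "a = cylinder v" "b = cylinder w"
      by auto
    then show "a \<inter> b \<in> ?E"
    proof cases
      case 2
      then show ?thesis using cylinder_Int[of v w] by auto
    qed auto
  qed
  have E: "sigma_sets UNIV ?E = sigma_sets UNIV (range cylinder)"
    by (rule sigma_sets_eqI) (auto intro: sigma_sets.Empty)
  show "sets \<nu> = sigma_sets UNIV ?E" "sets \<nu>' = sigma_sets UNIV ?E"
    using assms(1,2) by (simp_all add: E sets_shift_borel)
  show "range (\<lambda>i::nat. UNIV) \<subseteq> ?E" "(\<Union>i::nat. UNIV) = (UNIV :: (nat \<Rightarrow> 'm) set)"
    by (auto intro!: image_eqI[of _ _ "[]"] simp flip: cylinder_Nil)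
  show "emeasure \<nu> UNIV \<noteq> \<infinity>" for i :: nat
    using finite_measure.finite_emeasure_space[OF assms(3)] sets_eq_imp_space_eq[OF assms(1)] by simp
qed (use eq in auto)

lemma simple_function_initial_word:
  fixes \<nu> :: "(nat \<Rightarrow> 'm::finite) measure"
  assumes "sets \<nu> = sets shift_borel"
  shows "simple_function \<nu> (initial_word n)"
  unfolding simple_function_def
proof
  have sp: "space \<nu> = UNIV"
    using sets_eq_imp_space_eq[OF assms] by simp
  show "finite (initial_word n ` space \<nu>)"
    by (simp add: sp initial_word_image)
  show "\<forall>w\<in>initial_word n ` space \<nu>. initial_word n -` {w} \<inter> space \<nu> \<in> sets \<nu>"
    by (auto simp: sp initial_word_vimage assms cylinder_in_sets)
qed

definition cylinder_union :: "nat \<Rightarrow> 'm list set \<Rightarrow> (nat \<Rightarrow> 'm) set" where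
  "cylinder_union n S = {x. initial_word n x \<in> S}"

lemma cylinder_union_lift:
  assumes "n \<le> m"
  shows "cylinder_union n S = cylinder_union m {w. take n w \<in> S}"
  using assms by (simp add: cylinder_union_def take_initial_word)

lemma cylinder_union_in_sets:
  "cylinder_union n S \<in> sets (shift_borel :: (nat \<Rightarrow> 'm::finite) measure)"
proof -
  have "cylinder_union n S = (\<Union>w\<in>S \<inter> words n. cylinder w)"
    by (auto simp: cylinder_union_def mem_cylinder_iff words_def)
  also have "\<dots> \<in> sets shift_borel"
    by (intro sets.finite_UN) (auto intro: cylinder_in_sets)
  finally show ?thesis .
qed

text \<open>The sets that can be approximated in measure by finite unions of cylinders form a
  \<open>\<sigma>\<close>-algebra: a countable union is close to one of its finite partial unions.\<close>

lemma approximation_by_cylinders: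
  fixes \<nu> :: "(nat \<Rightarrow> 'm::finite) measure"
  assumes fin: "finite_measure \<nu>" and sets: "sets \<nu> = sets shift_borel"
    and B: "B \<in> sets \<nu>" and "0 < \<delta>"
  shows "\<exists>n S. measure \<nu> (sym_diff B (cylinder_union n S)) < \<delta>"
proof -
  interpret finite_measure \<nu> by fact
  have sp: "space \<nu> = UNIV"
    using sets_eq_imp_space_eq[OF sets] by simp
  have C: "cylinder_union n S \<in> sets \<nu>" for n S
    by (simp add: sets cylinder_union_in_sets)
  define approx where "approx B \<longleftrightarrow>
    (\<forall>\<delta>>0. \<exists>n S. measure \<nu> (sym_diff B (cylinder_union n S)) < \<delta>)" for B
  have Un: "approx (A \<union> B)" if AB: "A \<in> sets \<nu>" "B \<in> sets \<nu>" and ap: "approx A" "approx B" for A B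
    unfolding approx_def
  proof (intro allI impI)
    fix \<delta> :: real assume "0 < \<delta>"
    then have d: "0 < \<delta> / 2" by simp
    obtain n S where 1: "measure \<nu> (sym_diff A (cylinder_union n S)) < \<delta> / 2"
      using ap(1) d unfolding approx_def by blast
    obtain n' S' where 2: "measure \<nu> (sym_diff B (cylinder_union n' S')) < \<delta> / 2"
      using ap(2) d unfolding approx_def by blast
    let ?m = "max n n'"
    obtain R where R: "cylinder_union n S = cylinder_union ?m R"
      using cylinder_union_lift[of n ?m] by auto
    obtain R' where R': "cylinder_union n' S' = cylinder_union ?m R'"
      using cylinder_union_lift[of n' ?m] by auto
    have "measure \<nu> (sym_diff (A \<union> B) (cylinder_union ?m (R \<union> R')))
        \<le> measure \<nu> (sym_diff A (cylinder_union ?m R) \<union> sym_diff B (cylinder_union ?m R'))"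
      using AB C by (intro finite_measure_mono) (auto simp: cylinder_union_def)
    also have "\<dots> \<le> measure \<nu> (sym_diff A (cylinder_union ?m R))
        + measure \<nu> (sym_diff B (cylinder_union ?m R'))"
      using AB C by (intro measure_Un_le) auto
    also have "\<dots> < \<delta>"
      using 1 2 R R' by simp
    finally show "\<exists>n S. measure \<nu> (sym_diff (A \<union> B) (cylinder_union n S)) < \<delta>"
      by blast
  qed
  have empty: "approx {}"
    unfolding approx_def by (intro allI impI exI[of _ 0] exI[of _ "{}"]) (simp add: cylinder_union_def)
  have "B \<in> sigma_sets UNIV (range cylinder)"
    using B by (simp add: sets sets_shift_borel)
  then have "B \<in> sets \<nu> \<and> approx B"
  proof induction
    case (Basic a)
    then obtain w where a: "a = cylinder w" by auto
    have "a = cylinder_union (length w) {w}"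
      by (auto simp: a cylinder_union_def mem_cylinder_iff)
    then have "approx a"
      unfolding approx_def by (intro allI impI exI[of _ "length w"] exI[of _ "{w}"]) simp
    with a show ?case
      by (simp add: sets cylinder_in_sets)
  next
    case Empty
    then show ?case using empty by simp
  next
    case (Compl a)
    have "sym_diff (UNIV - a) (cylinder_union n (- S)) = sym_diff a (cylinder_union n S)" for n S
      by (auto simp: cylinder_union_def)
    then have "approx (UNIV - a)"
      using Compl unfolding approx_def by metis
    then show ?case
      using Compl sets.compl_sets[of a \<nu>] by (simp add: sp)
  next
    case (Union a)
    define U where "U N = (\<Union>i<N. a i)" for N :: nat
    have U_sets: "U N \<in> sets \<nu>" for N
      unfolding U_def using Union by auto
    have ap: "approx (U N)" for N
    proof (induction N)
      case (Suc N)
      have "U (Suc N) = U N \<union> a N"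
        by (auto simp: U_def less_Suc_eq)
      then show ?case
        using Un[OF U_sets _ Suc] Union by simp
    qed (simp add: U_def empty)
    have all: "(\<Union>i. a i) \<in> sets \<nu>"
      using Union by auto
    have UU: "(\<Union>N. U N) = (\<Union>i. a i)"
      by (auto simp: U_def)
    have "(\<lambda>N. measure \<nu> (U N)) \<longlonglongrightarrow> measure \<nu> (\<Union>N. U N)"
    proof (intro finite_Lim_measure_incseq)
      show "range U \<subseteq> sets \<nu>"
        using U_sets by auto
      show "incseq U"
        unfolding U_def by (intro monoI UN_mono) auto
    qed
    then have lim: "(\<lambda>N. measure \<nu> (U N)) \<longlonglongrightarrow> measure \<nu> (\<Union>i. a i)"
      by (simp only: UU)
    have "approx (\<Union>i. a i)"
      unfolding approx_def
    proof (intro allI impI)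
      fix \<delta> :: real assume "0 < \<delta>"
      then have d: "0 < \<delta> / 2" by simp
      have "eventually (\<lambda>N. measure \<nu> (\<Union>i. a i) - \<delta> / 2 < measure \<nu> (U N)) sequentially"
        by (rule order_tendstoD(1)[OF lim]) (use d in simp)
      then obtain N where N: "measure \<nu> (\<Union>i. a i) - \<delta> / 2 < measure \<nu> (U N)"
        by (auto simp: eventually_sequentially)
      obtain n S where nS: "measure \<nu> (sym_diff (U N) (cylinder_union n S)) < \<delta> / 2"
        using ap d unfolding approx_def by blast
      have sub: "U N \<subseteq> (\<Union>i. a i)"
        by (auto simp: U_def)
      have "measure \<nu> (sym_diff (\<Union>i. a i) (cylinder_union n S))
          \<le> measure \<nu> (((\<Union>i. a i) - U N) \<union> sym_diff (U N) (cylinder_union n S))"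
        using all U_sets C sub by (intro finite_measure_mono) auto
      also have "\<dots> \<le> measure \<nu> ((\<Union>i. a i) - U N) + measure \<nu> (sym_diff (U N) (cylinder_union n S))"
        using all U_sets C by (intro measure_Un_le) auto
      also have "measure \<nu> ((\<Union>i. a i) - U N) = measure \<nu> (\<Union>i. a i) - measure \<nu> (U N)"
        by (rule finite_measure_Diff[OF all U_sets sub])
      finally show "\<exists>n S. measure \<nu> (sym_diff (\<Union>i. a i) (cylinder_union n S)) < \<delta>"
        using N nS by (intro exI[of _ n] exI[of _ S]) simp
    qed
    with all show ?case by blast
  qed
  then show ?thesis
    using \<open>0 < \<delta>\<close> unfolding approx_def by blast
qed

text \<open>The inequality \<open>ln r \<le> r - 1\<close> at \<open>r = m * exp (- K) / t\<close>. For \<open>K = 0\<close> it controls cells that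
  nearly fill the conditioning set, for large \<open>K\<close> cells that occupy little of it.\<close>

lemma entropy_term_bound:
  fixes t m K :: real
  assumes "0 \<le> t" "t \<le> m"
  shows "- (t * ln t) + t * ln m \<le> K * t + m * exp (- K) - t"
proof (cases "t = 0")
  case True
  then show ?thesis using assms by simp
next
  case False
  then have t: "0 < t" "0 < m" using assms by auto
  then have "ln (m * exp (- K) / t) \<le> m * exp (- K) / t - 1"
    by (intro ln_le_minus_one) auto
  then have "t * ln (m * exp (- K) / t) \<le> t * (m * exp (- K) / t - 1)"
    using t by (intro mult_left_mono) auto
  then show ?thesis
    using t by (simp add: ln_div ln_mult algebra_simps)
qed

text \<open>The fibres of \<open>c\<close> are close to unions of cylinders of one length \<open>k\<close>, so given the initial word
  of length \<open>k\<close> each value of \<open>c\<close> is either almost certain or almost impossible. Both cases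
  contribute little to the conditional entropy.\<close>

lemma conditional_entropy_initial_word_small:
  fixes \<nu> :: "(nat \<Rightarrow> 'm::finite) measure"
  assumes pr: "prob_space \<nu>" and sets: "sets \<nu> = sets shift_borel"
    and c: "simple_function \<nu> c" and "0 < e"
  shows "\<exists>k. shannon \<nu> (\<lambda>x. (c x, initial_word k x)) - shannon \<nu> (initial_word k) \<le> e"
proof -
  interpret prob_space \<nu> by fact
  have sp: "space \<nu> = UNIV"
    using sets_eq_imp_space_eq[OF sets] by simp
  define R where "R = range c"
  have finR: "finite R" and fib: "c -` {p} \<in> sets \<nu>" for p
    using c simple_functionD[OF c] by (auto simp: R_def sp)
  have R0: "0 < real (card R)"
    using finR by (auto simp: R_def card_gt_0_iff)
  \<comment> \<open>\<open>K\<close> and \<open>\<delta>\<close> are chosen so that each of the \<open>card R\<close> values contributes at most \<open>e / card R\<close>.\<close>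
  define K where "K = max 0 (- ln (e / (2 * real (card R))))"
  have K: "0 \<le> K" "exp (- K) \<le> e / (2 * real (card R))"
  proof -
    have "exp (- K) \<le> exp (ln (e / (2 * real (card R))))"
      unfolding exp_le_cancel_iff K_def by linarith
    also have "\<dots> = e / (2 * real (card R))"
      using R0 \<open>0 < e\<close> by simp
    finally show "exp (- K) \<le> e / (2 * real (card R))" .
  qed (simp add: K_def)
  define \<delta> where "\<delta> = e / (2 * real (card R) * (1 + K))"
  have "0 < \<delta>"
    unfolding \<delta>_def using R0 K \<open>0 < e\<close> by simp
  have "\<exists>n S. measure \<nu> (sym_diff (c -` {p}) (cylinder_union n S)) < \<delta>" for p
    by (rule approximation_by_cylinders[OF finite_measure_axioms sets fib \<open>0 < \<delta>\<close>])
  then obtain n S where nS: "\<And>p. measure \<nu> (sym_diff (c -` {p}) (cylinder_union (n p) (S p))) < \<delta>"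
    by metis
  define k where "k = Max (n ` R)"
  have "n p \<le> k" if "p \<in> R" for p
    unfolding k_def using that finR by simp
  then have "\<exists>S'. cylinder_union (n p) (S p) = cylinder_union k S'" if "p \<in> R" for p
    using cylinder_union_lift that by blast
  then obtain S' where S': "\<And>p. p \<in> R \<Longrightarrow> cylinder_union (n p) (S p) = cylinder_union k (S' p)"
    by metis
  let ?w = "initial_word k"
  have sw: "simple_function \<nu> ?w"
    by (rule simple_function_initial_word[OF sets])
  define t where "t p q = measure \<nu> (c -` {p} \<inter> ?w -` {q})" for p q
  define m where "m q = measure \<nu> (?w -` {q})" for q
  have w_sets: "?w -` {q} \<in> sets \<nu>" for q
    using simple_functionD(2)[OF sw, of "{q}"] by (simp add: sp)
  have t: "0 \<le> t p q" "t p q \<le> m q" for p q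
    unfolding t_def m_def using w_sets by (auto intro!: finite_measure_mono)
  have m_sum: "m q = (\<Sum>p\<in>R. t p q)" for q
    unfolding m_def t_def measure_fibre_sum[OF c w_sets]
    by (simp add: R_def sp Int_commute)
  have w_sum: "measure \<nu> B = (\<Sum>q\<in>words k. measure \<nu> (B \<inter> ?w -` {q}))" if "B \<in> sets \<nu>" for B
    using measure_fibre_sum[OF sw that] by (simp add: sp initial_word_image)
  have total: "(\<Sum>q\<in>words k. m q) = 1"
    using w_sum[of UNIV] prob_space sets.top[of \<nu>] by (simp add: m_def sp)
  have H1: "shannon \<nu> ?w = - (\<Sum>q\<in>words k. \<Sum>p\<in>R. t p q * ln (m q))"
  proof -
    have "shannon \<nu> ?w = - (\<Sum>q\<in>words k. m q * ln (m q))"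
      by (simp add: shannon_def sp initial_word_image m_def)
    also have "(\<Sum>q\<in>words k. m q * ln (m q)) = (\<Sum>q\<in>words k. \<Sum>p\<in>R. t p q * ln (m q))"
      by (intro sum.cong refl) (metis m_sum sum_distrib_right)
    finally show ?thesis .
  qed
  have H2: "shannon \<nu> (\<lambda>x. (c x, ?w x)) = - (\<Sum>p\<in>R. \<Sum>q\<in>words k. t p q * ln (t p q))"
  proof -
    have v: "(\<lambda>x. (c x, ?w x)) -` {(p, q)} = c -` {p} \<inter> ?w -` {q}" for p q
      by auto
    have "(\<lambda>x. (c x, ?w x)) ` space \<nu> \<subseteq> R \<times> words k"
      by (auto simp: R_def words_def)
    then have "shannon \<nu> (\<lambda>x. (c x, ?w x)) = - (\<Sum>v\<in>R \<times> words k.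
        measure \<nu> ((\<lambda>x. (c x, ?w x)) -` {v} \<inter> space \<nu>) *
        ln (measure \<nu> ((\<lambda>x. (c x, ?w x)) -` {v} \<inter> space \<nu>)))"
      using finR by (intro shannon_superset) auto
    also have "\<dots> = - (\<Sum>(p, q)\<in>R \<times> words k. t p q * ln (t p q))"
      unfolding t_def v[symmetric] by (simp add: sp split_beta)
    finally show ?thesis
      by (simp add: sum.cartesian_product)
  qed
  have bound: "(\<Sum>q\<in>words k. - (t p q * ln (t p q)) + t p q * ln (m q)) \<le> \<delta> + K * \<delta> + exp (- K)"
    if p: "p \<in> R" for p
  proof -
    let ?B = "c -` {p}" and ?C = "cylinder_union k (S' p)"
    have C: "?C \<in> sets \<nu>"
      by (simp add: sets cylinder_union_in_sets)
    have small: "measure \<nu> (?C - ?B) \<le> \<delta>" "measure \<nu> (?B - ?C) \<le> \<delta>"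
    proof -
      have "measure \<nu> (?C - ?B) \<le> measure \<nu> (sym_diff ?B ?C)"
        "measure \<nu> (?B - ?C) \<le> measure \<nu> (sym_diff ?B ?C)"
        using C fib by (auto intro!: finite_measure_mono)
      then show "measure \<nu> (?C - ?B) \<le> \<delta>" "measure \<nu> (?B - ?C) \<le> \<delta>"
        using nS[of p] S'[OF p] by auto
    qed
    have cell: "- (t p q * ln (t p q)) + t p q * ln (m q)
        \<le> measure \<nu> ((?C - ?B) \<inter> ?w -` {q}) + K * measure \<nu> ((?B - ?C) \<inter> ?w -` {q}) + m q * exp (- K)" for q
    proof (cases "q \<in> S' p")
      case True
      have "m q - t p q = measure \<nu> (?w -` {q} - c -` {p} \<inter> ?w -` {q})"
        unfolding m_def t_def using fib w_sets by (intro finite_measure_Diff[symmetric]) auto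
      also have "?w -` {q} - c -` {p} \<inter> ?w -` {q} = (?C - ?B) \<inter> ?w -` {q}"
        using True by (auto simp: cylinder_union_def)
      finally have "m q - t p q = measure \<nu> ((?C - ?B) \<inter> ?w -` {q})" .
      moreover have "- (t p q * ln (t p q)) + t p q * ln (m q) \<le> m q - t p q"
        using entropy_term_bound[OF t(1) t(2), of p q 0] by simp
      moreover have "0 \<le> K * measure \<nu> ((?B - ?C) \<inter> ?w -` {q})" "0 \<le> m q * exp (- K)"
        using K by (auto simp: m_def)
      ultimately show ?thesis
        by linarith
    next
      case False
      then have "c -` {p} \<inter> ?w -` {q} = (?B - ?C) \<inter> ?w -` {q}"
        by (auto simp: cylinder_union_def)
      then have E: "t p q = measure \<nu> ((?B - ?C) \<inter> ?w -` {q})"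
        by (simp add: t_def)
      have "- (t p q * ln (t p q)) + t p q * ln (m q) \<le> K * t p q + m q * exp (- K)"
        using entropy_term_bound[OF t(1) t(2), of p q K] t(1)[of p q] by linarith
      moreover have "0 \<le> measure \<nu> ((?C - ?B) \<inter> ?w -` {q})"
        by simp
      ultimately show ?thesis
        unfolding E[symmetric] by linarith
    qed
    have "(\<Sum>q\<in>words k. - (t p q * ln (t p q)) + t p q * ln (m q))
        \<le> (\<Sum>q\<in>words k. measure \<nu> ((?C - ?B) \<inter> ?w -` {q})
          + K * measure \<nu> ((?B - ?C) \<inter> ?w -` {q}) + m q * exp (- K))"
      by (rule sum_mono) (rule cell)
    also have "\<dots> = measure \<nu> (?C - ?B) + K * measure \<nu> (?B - ?C) + exp (- K)"
      using w_sum[of "?C - ?B"] w_sum[of "?B - ?C"] C fib total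
      by (simp add: sum.distrib sum_distrib_left[symmetric] sum_distrib_right[symmetric])
    also have "\<dots> \<le> \<delta> + K * \<delta> + exp (- K)"
      using small K by (intro add_mono mult_left_mono) auto
    finally show ?thesis .
  qed
  have "shannon \<nu> (\<lambda>x. (c x, ?w x)) - shannon \<nu> ?w
      = (\<Sum>p\<in>R. \<Sum>q\<in>words k. - (t p q * ln (t p q)) + t p q * ln (m q))"
    unfolding H1 H2 sum.swap[of "\<lambda>q p. t p q * ln (m q)" R "words k"]
    by (simp add: sum.distrib sum_negf sum_subtractf)
  also have "\<dots> \<le> (\<Sum>p\<in>R. \<delta> + K * \<delta> + exp (- K))"
    by (rule sum_mono) (rule bound)
  also have "\<dots> = real (card R) * (\<delta> * (1 + K)) + real (card R) * exp (- K)"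
    by (simp add: algebra_simps)
  also have "\<dots> \<le> e / 2 + e / 2"
  proof (rule add_mono)
    show "real (card R) * (\<delta> * (1 + K)) \<le> e / 2"
    proof -
      have "1 + K \<noteq> 0"
        using K(1) by linarith
      then show ?thesis
        unfolding \<delta>_def using R0 by simp
    qed
    show "real (card R) * exp (- K) \<le> e / 2"
      using K(2) R0 by (simp add: field_simps)
  qed
  finally show ?thesis
    by (intro exI[of _ k]) simp
qed

lemma invariant_measures_measure_preserving:
  assumes "\<nu> \<in> invariant_measures"
  shows "measure_preserving \<nu> shift"
proof -
  have s: "sets \<nu> = sets shift_borel" and d: "distr \<nu> \<nu> shift = \<nu>" and p: "prob_space \<nu>"
    using assms by (auto simp: invariant_measures_def)
  have "shift \<in> measurable \<nu> \<nu>"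
    using measurable_shift measurable_cong_sets[OF s s] by blast
  with p d show ?thesis
    by (simp add: measure_preserving_def measure_preserving_axioms_def)
qed

text \<open>The zeroth coordinate generates the full shift, so the metric entropy is the growth rate of the
  entropy of initial words. In particular it is finite.\<close>

lemma metric_entropy_shift:
  fixes \<nu> :: "(nat \<Rightarrow> 'm::finite) measure"
  assumes "\<nu> \<in> invariant_measures"
  obtains h where "metric_entropy \<nu> shift = ereal h"
    "(\<lambda>n. shannon \<nu> (initial_word n) / real n) \<longlonglongrightarrow> h"
proof -
  interpret measure_preserving \<nu> shift
    by (rule invariant_measures_measure_preserving[OF assms])
  have s: "sets \<nu> = sets shift_borel"
    using assms by (auto simp: invariant_measures_def)
  let ?X = "\<lambda>x :: nat \<Rightarrow> 'm. x 0"
  have "simple_function \<nu> (\<lambda>x. hd (initial_word 1 x))"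
    by (rule simple_function_compose1) (rule simple_function_initial_word[OF s])
  then have X: "simple_function \<nu> ?X"
    by (simp add: initial_word_def)
  have "metric_entropy \<nu> shift = ereal (entropy_rate ?X)"
  proof (rule metric_entropy_generator[OF X])
    fix c :: "_ \<Rightarrow> (nat \<Rightarrow> 'm) set" and e :: real
    assume "simple_function \<nu> c" "0 < e"
    then show "\<exists>k. shannon \<nu> (\<lambda>x. (c x, itinerary shift ?X k x))
        - shannon \<nu> (itinerary shift ?X k) \<le> e"
      using conditional_entropy_initial_word_small[OF prob_space_axioms s]
      by (simp add: itinerary_shift)
  qed
  moreover have "(\<lambda>n. shannon \<nu> (initial_word n) / real n) \<longlonglongrightarrow> entropy_rate ?X"
    using entropy_rate_tendsto[OF X] by (simp add: itinerary_shift)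
  ultimately show thesis
    by (rule that)
qed

section \<open>Gibbs weights of a quasi-multiplicative potential\<close>

lemma sum_words_append:
  "(\<Sum>w\<in>words (m + n). f w) = (\<Sum>u\<in>words m. \<Sum>v\<in>words n. f (u @ v))"
proof -
  have "(\<Sum>w\<in>words (m + n). f w) = (\<Sum>(u, v)\<in>words m \<times> words n. f (u @ v))"
    by (rule sum.reindex_bij_witness[where i = "\<lambda>(u, v). u @ v" and j = "\<lambda>w. (take m w, drop m w)"])
      (auto simp: words_def)
  then show ?thesis
    by (simp add: sum.cartesian_product)
qed

lemma sum_words_1: "(\<Sum>w\<in>words 1. f w) = (\<Sum>i\<in>UNIV. f [i])"
  by (rule sum.reindex_bij_witness[where i = "\<lambda>i. [i]" and j = hd])
    (auto simp: words_def length_Suc_conv)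

lemma words_0 [simp]: "words 0 = {[]}"
  by (auto simp: words_def)

text \<open>The function \<open>N\<close> abstracts \<open>w \<mapsto> \<parallel>A\<^sub>w\<parallel>\<^sup>s\<close>. Such a potential need not be bounded below by a multiple
  of \<open>N u * N v\<close> on \<open>u @ v\<close>, but it is after inserting a connecting word from a finite set.\<close>

locale quasi_multiplicative =
  fixes N :: "'m::finite list \<Rightarrow> real"
  assumes N_pos: "0 < N w"
    and N_append: "N (u @ v) \<le> N u * N v"
    and N_quasi: "\<exists>K c. finite K \<and> 0 < c \<and> (\<forall>u v. \<exists>\<kappa>\<in>K. c * (N u * N v) \<le> N (u @ \<kappa> @ v))"
begin

text \<open>The partition function of length \<open>n\<close>.\<close>

definition Z :: "nat \<Rightarrow> real" where
  "Z n = (\<Sum>w\<in>words n. N w)"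

text \<open>The total weight of the words of length \<open>j + length w + k\<close> that contain \<open>w\<close> at position \<open>j\<close>.\<close>

definition S :: "nat \<Rightarrow> nat \<Rightarrow> 'm list \<Rightarrow> real" where
  "S j k w = (\<Sum>u\<in>words j. \<Sum>v\<in>words k. N (u @ w @ v))"

lemma N_nonneg: "0 \<le> N w"
  using N_pos[of w] by simp

lemma words_nonempty: "words n \<noteq> ({} :: 'm list set)"
proof -
  have "replicate n undefined \<in> words n"
    by (simp add: words_def)
  then show ?thesis by blast
qed

lemma Z_pos: "0 < Z n"
  unfolding Z_def by (intro sum_pos) (auto simp: N_pos words_nonempty)

lemma N_le_Z: "N w \<le> Z (length w)"
  unfolding Z_def by (rule member_le_sum) (auto simp: words_def N_nonneg finite_words[unfolded words_def])

lemma Z_add_le: "Z (m + n) \<le> Z m * Z n"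
  unfolding Z_def sum_words_append sum_product by (intro sum_mono N_append)

lemma Z_product: "c * (Z j * Z k) = (\<Sum>u\<in>words j. \<Sum>v\<in>words k. c * (N u * N v))"
  unfolding Z_def by (subst sum_product) (simp only: sum_distrib_left)

lemma S_nonneg: "0 \<le> S j k w"
  unfolding S_def by (intro sum_nonneg N_nonneg)

lemma S_le: "S j k w \<le> N w * (Z j * Z k)"
proof -
  have "N (u @ w @ v) \<le> N w * (N u * N v)" for u v
  proof -
    have "N (u @ w @ v) \<le> N u * N (w @ v)"
      by (rule N_append)
    also have "\<dots> \<le> N u * (N w * N v)"
      by (intro mult_left_mono N_append N_nonneg)
    finally show ?thesis by (simp add: ac_simps)
  qed
  then have "S j k w \<le> (\<Sum>u\<in>words j. \<Sum>v\<in>words k. N w * (N u * N v))"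
    unfolding S_def by (intro sum_mono)
  also have "\<dots> = N w * (Z j * Z k)"
    by (rule Z_product[symmetric])
  finally show ?thesis .
qed

lemma sum_S_middle: "(\<Sum>w\<in>words n. S j k w) = Z (j + (n + k))"
  unfolding Z_def S_def sum_words_append[of _ j] sum_words_append[of _ n k]
  by (subst sum.swap) (rule refl)

lemma S_middle_le: "S j k w \<le> Z (length w) * Z (j + k)"
proof -
  have "S j k w \<le> (\<Sum>w\<in>words (length w). S j k w)"
    by (rule member_le_sum) (auto simp: words_def S_nonneg finite_words[unfolded words_def])
  also have "\<dots> = Z (length w + (j + k))"
    by (simp add: sum_S_middle ac_simps)
  also have "\<dots> \<le> Z (length w) * Z (j + k)"
    by (rule Z_add_le)
  finally show ?thesis .
qed

text \<open>Summing over a letter adjacent to \<open>w\<close> lengthens the context by one. This and its mirror image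
  are the reason that limits of the averages of \<open>S\<close> are consistent and shift-invariant.\<close>

lemma S_snoc: "(\<Sum>i\<in>UNIV. S j k (w @ [i])) = S j (Suc k) w"
proof -
  have "(\<Sum>i\<in>UNIV. S j k (w @ [i])) = (\<Sum>u\<in>words j. \<Sum>i\<in>UNIV. \<Sum>v\<in>words k. N (u @ w @ [i] @ v))"
    unfolding S_def by (subst sum.swap) simp
  also have "\<dots> = S j (1 + k) w"
    unfolding S_def sum_words_append[of _ 1 k] sum_words_1 by (rule refl)
  finally show ?thesis by simp
qed

lemma S_Cons: "(\<Sum>i\<in>UNIV. S j k (i # w)) = S (Suc j) k w"
proof -
  have "(\<Sum>i\<in>UNIV. S j k (i # w)) = (\<Sum>u\<in>words j. \<Sum>i\<in>UNIV. \<Sum>v\<in>words k. N ((u @ [i]) @ w @ v))"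
    unfolding S_def by (subst sum.swap) simp
  also have "\<dots> = S (j + 1) k w"
    unfolding S_def sum_words_append[of _ j 1] sum_words_1 by (rule refl)
  finally show ?thesis by simp
qed

lemma S_outer_le: "S (a + j) (k + b) w \<le> Z a * Z b * S j k w"
proof -
  have "N ((y @ u) @ w @ v @ z) \<le> N y * N z * N (u @ w @ v)" for y u v z
  proof -
    have "N ((y @ u) @ w @ v @ z) = N (y @ ((u @ w @ v) @ z))"
      by simp
    also have "\<dots> \<le> N y * N ((u @ w @ v) @ z)"
      by (rule N_append)
    also have "\<dots> \<le> N y * (N (u @ w @ v) * N z)"
      by (intro mult_left_mono N_append N_nonneg)
    finally show ?thesis by (simp add: ac_simps)
  qed
  then have "S (a + j) (k + b) w
      \<le> (\<Sum>y\<in>words a. \<Sum>u\<in>words j. \<Sum>v\<in>words k. \<Sum>z\<in>words b. N y * N z * N (u @ w @ v))"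
    unfolding S_def sum_words_append by (intro sum_mono)
  also have "\<dots> = (\<Sum>y\<in>words a. \<Sum>u\<in>words j. \<Sum>v\<in>words k. N y * Z b * N (u @ w @ v))"
    by (simp add: Z_def sum_distrib_left sum_distrib_right)
  also have "\<dots> = (\<Sum>y\<in>words a. N y * Z b * S j k w)"
    by (simp only: S_def sum_distrib_left)
  also have "\<dots> = Z a * Z b * S j k w"
    by (simp only: Z_def[of a] sum_distrib_right)
  finally show ?thesis .
qed

text \<open>Insert connecting words around \<open>w\<close>. The resulting words are longer than \<open>j + length w + k\<close>
  by a bounded amount, and cutting off the surplus letters costs only a bounded factor by
  submultiplicativity.\<close>

lemma partition_function_comparison:
  obtains C where "0 < C" "\<And>m n. Z m * Z n \<le> C * Z (m + n)"
    "\<And>w. \<exists>a>0. \<forall>j k. a * (Z j * Z k) \<le> S j k w"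
proof -
  obtain K c where K: "finite K" and c: "0 < c"
    and q: "\<And>u v. \<exists>\<kappa>\<in>K. c * (N u * N v) \<le> N (u @ \<kappa> @ v)"
    using N_quasi by blast
  have conn: "c * (N u * N v) \<le> (\<Sum>\<kappa>\<in>K. N (u @ \<kappa> @ v))" for u v
  proof -
    obtain \<kappa> where "\<kappa> \<in> K" "c * (N u * N v) \<le> N (u @ \<kappa> @ v)"
      using q by blast
    moreover from this have "N (u @ \<kappa> @ v) \<le> (\<Sum>\<kappa>\<in>K. N (u @ \<kappa> @ v))"
      using K by (intro member_le_sum) (auto simp: N_nonneg)
    ultimately show ?thesis by linarith
  qed
  define Q where "Q = (\<Sum>\<kappa>\<in>K. Z (length \<kappa>))"
  have "K \<noteq> {}"
    using q[of "[]" "[]"] by auto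
  then have Q: "0 < Q"
    unfolding Q_def using K by (intro sum_pos Z_pos) auto
  have 1: "Z m * Z n \<le> (Q / c) * Z (m + n)" for m n
  proof -
    have "c * (Z m * Z n) = (\<Sum>u\<in>words m. \<Sum>v\<in>words n. c * (N u * N v))"
      by (rule Z_product)
    also have "\<dots> \<le> (\<Sum>u\<in>words m. \<Sum>v\<in>words n. \<Sum>\<kappa>\<in>K. N (u @ \<kappa> @ v))"
      by (intro sum_mono conn)
    also have "\<dots> = (\<Sum>u\<in>words m. \<Sum>\<kappa>\<in>K. \<Sum>v\<in>words n. N (u @ \<kappa> @ v))"
      by (intro sum.cong refl sum.swap)
    also have "\<dots> = (\<Sum>\<kappa>\<in>K. S m n \<kappa>)"
      unfolding S_def by (rule sum.swap)
    also have "\<dots> \<le> (\<Sum>\<kappa>\<in>K. Z (length \<kappa>) * Z (m + n))"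
      by (intro sum_mono S_middle_le)
    also have "\<dots> = Q * Z (m + n)"
      by (simp add: Q_def sum_distrib_right)
    finally show ?thesis
      using c by (simp add: field_simps)
  qed
  have 2: "(c * c * N w / (Q * Q)) * (Z j * Z k) \<le> S j k w" for w j k
  proof -
    have T: "(\<Sum>u\<in>words j. \<Sum>v\<in>words k. N (u @ \<kappa> @ w @ \<kappa>' @ v))
        \<le> Z (length \<kappa>) * Z (length \<kappa>') * S j k w" for \<kappa> \<kappa>'
    proof -
      have "(\<Sum>u\<in>words j. \<Sum>v\<in>words k. N (u @ \<kappa> @ w @ \<kappa>' @ v))
          \<le> (\<Sum>u\<in>words j. \<Sum>y\<in>words (length \<kappa>). \<Sum>z\<in>words (length \<kappa>'). \<Sum>v\<in>words k.
              N (u @ y @ w @ z @ v))"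
      proof (rule sum_mono)
        fix u
        have "(\<Sum>v\<in>words k. N (u @ \<kappa> @ w @ \<kappa>' @ v))
            \<le> (\<Sum>z\<in>words (length \<kappa>'). \<Sum>v\<in>words k. N (u @ \<kappa> @ w @ z @ v))"
          by (rule member_le_sum[where f = "\<lambda>z. \<Sum>v\<in>words k. N (u @ \<kappa> @ w @ z @ v)"])
            (auto simp: words_def[of "length \<kappa>'"] finite_words[unfolded words_def] intro!: sum_nonneg N_nonneg)
        also have "\<dots> \<le> (\<Sum>y\<in>words (length \<kappa>). \<Sum>z\<in>words (length \<kappa>'). \<Sum>v\<in>words k.
              N (u @ y @ w @ z @ v))"
          by (rule member_le_sum[where f = "\<lambda>y. \<Sum>z\<in>words (length \<kappa>'). \<Sum>v\<in>words k. N (u @ y @ w @ z @ v)"])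
            (auto simp: words_def[of "length \<kappa>"] finite_words[unfolded words_def] intro!: sum_nonneg N_nonneg)
        finally show "(\<Sum>v\<in>words k. N (u @ \<kappa> @ w @ \<kappa>' @ v))
            \<le> (\<Sum>y\<in>words (length \<kappa>). \<Sum>z\<in>words (length \<kappa>'). \<Sum>v\<in>words k. N (u @ y @ w @ z @ v))" .
      qed
      also have "\<dots> = S (j + length \<kappa>) (length \<kappa>' + k) w"
        unfolding S_def sum_words_append by simp
      also have "\<dots> = S (length \<kappa> + j) (k + length \<kappa>') w"
        by (simp only: add.commute)
      also have "\<dots> \<le> Z (length \<kappa>) * Z (length \<kappa>') * S j k w"
        by (rule S_outer_le)
      finally show ?thesis .
    qed
    have conn2: "c * c * N w * (N u * N v) \<le> (\<Sum>\<kappa>\<in>K. \<Sum>\<kappa>'\<in>K. N (u @ \<kappa> @ w @ \<kappa>' @ v))" for u v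
    proof -
      have "c * c * N w * (N u * N v) = c * N v * (c * (N u * N w))"
        by (simp add: ac_simps)
      also have "\<dots> \<le> c * N v * (\<Sum>\<kappa>\<in>K. N (u @ \<kappa> @ w))"
        using c by (intro mult_left_mono conn mult_nonneg_nonneg N_nonneg) auto
      also have "\<dots> = (\<Sum>\<kappa>\<in>K. c * (N (u @ \<kappa> @ w) * N v))"
        by (simp add: sum_distrib_left ac_simps)
      also have "\<dots> \<le> (\<Sum>\<kappa>\<in>K. \<Sum>\<kappa>'\<in>K. N ((u @ \<kappa> @ w) @ \<kappa>' @ v))"
        by (intro sum_mono conn)
      finally show ?thesis by simp
    qed
    have "c * c * N w * (Z j * Z k) = (\<Sum>u\<in>words j. \<Sum>v\<in>words k. c * c * N w * (N u * N v))"
      by (rule Z_product)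
    also have "\<dots> \<le> (\<Sum>u\<in>words j. \<Sum>v\<in>words k. \<Sum>\<kappa>\<in>K. \<Sum>\<kappa>'\<in>K. N (u @ \<kappa> @ w @ \<kappa>' @ v))"
      by (intro sum_mono conn2)
    also have "\<dots> = (\<Sum>u\<in>words j. \<Sum>\<kappa>\<in>K. \<Sum>v\<in>words k. \<Sum>\<kappa>'\<in>K. N (u @ \<kappa> @ w @ \<kappa>' @ v))"
      by (rule sum.cong[OF refl], rule sum.swap)
    also have "\<dots> = (\<Sum>\<kappa>\<in>K. \<Sum>u\<in>words j. \<Sum>v\<in>words k. \<Sum>\<kappa>'\<in>K. N (u @ \<kappa> @ w @ \<kappa>' @ v))"
      by (rule sum.swap)
    also have "\<dots> = (\<Sum>\<kappa>\<in>K. \<Sum>u\<in>words j. \<Sum>\<kappa>'\<in>K. \<Sum>v\<in>words k. N (u @ \<kappa> @ w @ \<kappa>' @ v))"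
      by (rule sum.cong[OF refl], rule sum.cong[OF refl], rule sum.swap)
    also have "\<dots> = (\<Sum>\<kappa>\<in>K. \<Sum>\<kappa>'\<in>K. \<Sum>u\<in>words j. \<Sum>v\<in>words k. N (u @ \<kappa> @ w @ \<kappa>' @ v))"
      by (rule sum.cong[OF refl], rule sum.swap)
    also have "\<dots> \<le> (\<Sum>\<kappa>\<in>K. \<Sum>\<kappa>'\<in>K. Z (length \<kappa>) * Z (length \<kappa>') * S j k w)"
      by (intro sum_mono T)
    also have "\<dots> = Q * Q * S j k w"
      unfolding Q_def by (subst sum_product) (simp only: sum_distrib_right)
    finally show ?thesis
      using Q by (simp add: field_simps)
  qed
  show thesis
  proof (rule that[of "Q / c"])
    show "\<exists>a>0. \<forall>j k. a * (Z j * Z k) \<le> S j k w" for w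
      using 2[of w] Q c N_pos[of w]
      by (intro exI[of _ "c * c * N w / (Q * Q)"]) simp
  qed (use Q c 1 in auto)
qed

text \<open>Both \<open>ln (Z n)\<close> and \<open>ln C - ln (Z n)\<close> are subadditive, so Fekete's lemma applies to each and
  gives the upper and the lower bound with the same growth rate.\<close>

lemma pressure_exists:
  obtains L C where "0 < C" "(\<lambda>n. ln (Z n) / real n) \<longlonglongrightarrow> L"
    "\<And>n. exp (real n * L) \<le> Z n" "\<And>n. Z n \<le> C * exp (real n * L)"
proof -
  obtain C where C: "0 < C" "\<And>m n. Z m * Z n \<le> C * Z (m + n)"
    using partition_function_comparison by metis
  define a where "a n = ln (Z n)" for n
  define b where "b n = ln C - ln (Z n)" for n
  have sub_a: "a (m + n) \<le> a m + a n" for m n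
  proof -
    have "ln (Z (m + n)) \<le> ln (Z m * Z n)"
      using Z_add_le Z_pos by (subst ln_le_cancel_iff) auto
    also have "\<dots> = ln (Z m) + ln (Z n)"
      using Z_pos by (intro ln_mult_pos)
    finally show ?thesis
      by (simp add: a_def)
  qed
  have sub_b: "b (m + n) \<le> b m + b n" for m n
  proof -
    have "ln (Z m) + ln (Z n) = ln (Z m * Z n)"
      using Z_pos by (intro ln_mult_pos[symmetric])
    also have "\<dots> \<le> ln (C * Z (m + n))"
      using C Z_pos by (subst ln_le_cancel_iff) auto
    also have "\<dots> = ln C + ln (Z (m + n))"
      using C(1) Z_pos by (intro ln_mult_pos)
    finally show ?thesis
      by (simp add: b_def)
  qed
  have a0: "0 \<le> a 0" and b0: "0 \<le> b 0"
    using sub_a[of 0 0] sub_b[of 0 0] by simp_all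
  have lower_a: "- (\<bar>b 1\<bar> + \<bar>b 0\<bar> + \<bar>ln C\<bar>) * real n \<le> a n" for n
  proof (cases n)
    case (Suc m)
    have "b n \<le> real n * b 1 + b 0"
      using subadditive_multiple_le[OF sub_b, of n 1 0] by simp
    moreover have "real n * b 1 \<le> real n * \<bar>b 1\<bar>"
      by (intro mult_left_mono) auto
    moreover have "1 * \<bar>b 0\<bar> \<le> real n * \<bar>b 0\<bar>" "1 * \<bar>ln C\<bar> \<le> real n * \<bar>ln C\<bar>"
      using Suc by (intro mult_right_mono; simp)+
    moreover have "a n = ln C - b n"
      by (simp add: a_def b_def)
    ultimately show ?thesis
      by (simp add: algebra_simps)
  qed (use a0 in simp)
  have lower_b: "- (\<bar>a 1\<bar> + \<bar>a 0\<bar> + \<bar>ln C\<bar>) * real n \<le> b n" for n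
  proof (cases n)
    case (Suc m)
    have "a n \<le> real n * a 1 + a 0"
      using subadditive_multiple_le[OF sub_a, of n 1 0] by simp
    moreover have "real n * a 1 \<le> real n * \<bar>a 1\<bar>"
      by (intro mult_left_mono) auto
    moreover have "1 * \<bar>a 0\<bar> \<le> real n * \<bar>a 0\<bar>" "1 * \<bar>ln C\<bar> \<le> real n * \<bar>ln C\<bar>"
      using Suc by (intro mult_right_mono; simp)+
    moreover have "b n = ln C - a n"
      by (simp add: a_def b_def)
    ultimately show ?thesis
      by (simp add: algebra_simps)
  qed (use b0 in simp)
  obtain L where L: "(\<lambda>n. a n / real n) \<longlonglongrightarrow> L" "\<And>n. real n * L \<le> a n"
    using fekete_real[OF sub_a lower_a] by blast
  obtain L' where L': "(\<lambda>n. b n / real n) \<longlonglongrightarrow> L'" "\<And>n. real n * L' \<le> b n"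
    using fekete_real[OF sub_b lower_b] by blast
  have "(\<lambda>n. ln C / real n - a n / real n) \<longlonglongrightarrow> 0 - L"
    by (intro tendsto_diff lim_const_over_n L)
  moreover have "(\<lambda>n. ln C / real n - a n / real n) = (\<lambda>n. b n / real n)"
    by (simp add: b_def a_def diff_divide_distrib)
  ultimately have "L' = - L"
    using L'(1) LIMSEQ_unique by fastforce
  show thesis
  proof (rule that[OF C(1)])
    show "(\<lambda>n. ln (Z n) / real n) \<longlonglongrightarrow> L"
      using L(1) by (simp add: a_def)
    show "exp (real n * L) \<le> Z n" for n
      using L(2)[of n] Z_pos[of n] by (simp add: a_def ln_ge_iff)
    show "Z n \<le> C * exp (real n * L)" for n
    proof -
      have "exp (ln (Z n)) \<le> exp (ln C + real n * L)"
        using L'(2)[of n] \<open>L' = - L\<close> by (simp add: b_def)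
      then show ?thesis
        using Z_pos[of n] C(1) by (simp add: exp_add)
    qed
  qed
qed

text \<open>The normalised sums \<open>s j k w\<close> lie between positive constants that depend only on \<open>w\<close>.
  Averaging them over \<open>j, k < n\<close> makes them consistent and invariant up to an error of order
  \<open>1 / n\<close>, and a diagonal subsequence of the averages converges for all words.\<close>

lemma gibbs_weights:
  obtains p L D where "(\<lambda>n. ln (Z n) / real n) \<longlonglongrightarrow> L" "0 < D"
    "\<And>w. p w \<le> D * exp (- real (length w) * L) * N w" "\<And>w. 0 < p w" "p [] = 1"
    "\<And>w. (\<Sum>i\<in>UNIV. p (w @ [i])) = p w" "\<And>w. (\<Sum>i\<in>UNIV. p (i # w)) = p w"
proof -
  obtain L C where C: "0 < C" and L: "(\<lambda>n. ln (Z n) / real n) \<longlonglongrightarrow> L"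
    and lower: "\<And>n. exp (real n * L) \<le> Z n" and upper: "\<And>n. Z n \<le> C * exp (real n * L)"
    using pressure_exists by metis
  define s where "s j k w = exp (- real (j + k + length w) * L) * S j k w" for j k w
  define D where "D w = C * C * (exp (- real (length w) * L) * N w)" for w
  have s_le: "s j k w \<le> D w" and s_nonneg: "0 \<le> s j k w" for j k w
  proof -
    have "S j k w \<le> N w * (Z j * Z k)"
      by (rule S_le)
    also have "\<dots> \<le> N w * ((C * exp (real j * L)) * (C * exp (real k * L)))"
      using C Z_pos by (intro mult_left_mono mult_mono upper N_nonneg) (auto simp: less_imp_le)
    finally have "s j k w \<le> exp (- real (j + k + length w) * L)
        * (N w * ((C * exp (real j * L)) * (C * exp (real k * L))))"
      unfolding s_def by (rule mult_left_mono) simp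
    also have "\<dots> = C * C * N w * (exp (- real (j + k + length w) * L) * exp (real j * L) * exp (real k * L))"
      by (simp only: ac_simps)
    also have "exp (- real (j + k + length w) * L) * exp (real j * L) * exp (real k * L)
        = exp (- real (length w) * L)"
      by (simp add: exp_add[symmetric] algebra_simps)
    finally show "s j k w \<le> D w"
      by (simp add: D_def ac_simps)
    show "0 \<le> s j k w"
      by (simp add: s_def S_nonneg)
  qed
  have s_ge: "\<exists>d>0. \<forall>j k. d \<le> s j k w" for w
  proof -
    obtain a where a: "0 < a" "\<And>j k. a * (Z j * Z k) \<le> S j k w"
      using partition_function_comparison by metis
    have "a * exp (- real (length w) * L) \<le> s j k w" for j k
    proof -
      have "a * exp (- real (length w) * L)
          = exp (- real (j + k + length w) * L) * (a * (exp (real j * L) * exp (real k * L)))"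
        by (simp add: exp_add[symmetric] algebra_simps)
      also have "\<dots> \<le> exp (- real (j + k + length w) * L) * (a * (Z j * Z k))"
        using a(1) Z_pos by (intro mult_left_mono mult_mono lower) (auto simp: less_imp_le)
      also have "\<dots> \<le> s j k w"
        unfolding s_def by (intro mult_left_mono a(2)) simp
      finally show ?thesis .
    qed
    then show ?thesis
      using a(1) by (intro exI[of _ "a * exp (- real (length w) * L)"]) simp
  qed
  have s_snoc: "(\<Sum>i\<in>UNIV. s j k (w @ [i])) = s j (Suc k) w" for j k w
    unfolding s_def S_snoc[symmetric] by (simp add: sum_distrib_left)
  have s_Cons: "(\<Sum>i\<in>UNIV. s j k (i # w)) = s (Suc j) k w" for j k w
    unfolding s_def S_Cons[symmetric] by (simp add: sum_distrib_left)
  define b where "b n w = (\<Sum>j<n. \<Sum>k<n. s j k w) / (real n * real n)" for n w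
  have b_le: "b n w \<le> D w" if "n > 0" for n w
  proof -
    have "(\<Sum>j<n. \<Sum>k<n. s j k w) \<le> (\<Sum>j<n. \<Sum>k<n. D w)"
      by (intro sum_mono s_le)
    then show ?thesis
      using that by (simp add: b_def field_simps)
  qed
  have b_ge: "d \<le> b n w" if "n > 0" "\<And>j k. d \<le> s j k w" for d n w
  proof -
    have "(\<Sum>j<n. \<Sum>k<n. d) \<le> (\<Sum>j<n. \<Sum>k<n. s j k w)"
      by (intro sum_mono that)
    then show ?thesis
      using that(1) by (simp add: b_def field_simps)
  qed
  have D_le: "D w \<le> C * C * C" for w
  proof -
    have "exp (- real (length w) * L) * N w \<le> exp (- real (length w) * L) * (C * exp (real (length w) * L))"
      using N_le_Z[of w] upper[of "length w"] by (intro mult_left_mono) auto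
    also have "\<dots> = C"
      by (simp add: exp_minus)
    finally show ?thesis
      unfolding D_def using C by (intro mult_left_mono) auto
  qed
  \<comment> \<open>Moving the averaging window by one changes only the two boundary terms.\<close>
  have tele: "\<bar>(\<Sum>k<n. f (Suc k)) - (\<Sum>k<n. f k)\<bar> \<le> M"
    if "\<And>k. 0 \<le> f k" "\<And>k. f k \<le> M" for f :: "nat \<Rightarrow> real" and n M
    using that(1)[of 0] that(1)[of n] that(2)[of 0] that(2)[of n]
    by (simp add: sum_subtractf[symmetric] sum_lessThan_telescope)
  have err_snoc: "\<bar>(\<Sum>i\<in>UNIV. b n (w @ [i])) - b n w\<bar> \<le> D w / real n" if "n > 0" for n w
  proof -
    have "(\<Sum>i\<in>UNIV. \<Sum>j<n. \<Sum>k<n. s j k (w @ [i])) = (\<Sum>j<n. \<Sum>k<n. s j (Suc k) w)"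
      unfolding s_snoc[symmetric]
      by (subst sum.swap, rule sum.cong[OF refl], rule sum.swap)
    then have "(\<Sum>i\<in>UNIV. b n (w @ [i])) - b n w
        = (\<Sum>j<n. (\<Sum>k<n. s j (Suc k) w) - (\<Sum>k<n. s j k w)) / (real n * real n)"
      by (simp add: b_def sum_divide_distrib[symmetric] sum_subtractf diff_divide_distrib)
    also have "\<bar>\<dots>\<bar> \<le> (\<Sum>j<n. D w) / (real n * real n)"
      unfolding abs_divide
      by (intro divide_mono order.trans[OF sum_abs] sum_mono tele s_nonneg s_le) (use that in auto)
    also have "\<dots> = D w / real n"
      using that by simp
    finally show ?thesis .
  qed
  have err_Cons: "\<bar>(\<Sum>i\<in>UNIV. b n (i # w)) - b n w\<bar> \<le> D w / real n" if "n > 0" for n w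
  proof -
    have "(\<Sum>i\<in>UNIV. \<Sum>j<n. \<Sum>k<n. s j k (i # w)) = (\<Sum>k<n. \<Sum>j<n. s (Suc j) k w)"
      unfolding s_Cons[symmetric]
      by (subst (4) sum.swap, subst sum.swap, rule sum.cong[OF refl], rule sum.swap)
    moreover have "(\<Sum>j<n. \<Sum>k<n. s j k w) = (\<Sum>k<n. \<Sum>j<n. s j k w)"
      by (rule sum.swap)
    ultimately have "(\<Sum>i\<in>UNIV. b n (i # w)) - b n w
        = (\<Sum>k<n. (\<Sum>j<n. s (Suc j) k w) - (\<Sum>j<n. s j k w)) / (real n * real n)"
      by (simp add: b_def sum_divide_distrib[symmetric] sum_subtractf diff_divide_distrib)
    also have "\<bar>\<dots>\<bar> \<le> (\<Sum>j<n. D w) / (real n * real n)"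
      unfolding abs_divide
      by (intro divide_mono order.trans[OF sum_abs] sum_mono tele[of "\<lambda>j. s j _ w"] s_nonneg s_le)
        (use that in auto)
    also have "\<dots> = D w / real n"
      using that by simp
    finally show ?thesis .
  qed
  have b_nonneg: "0 \<le> b n w" for n w
    unfolding b_def by (intro divide_nonneg_nonneg sum_nonneg s_nonneg) simp
  have norm: "norm (b (Suc n) w) \<le> C * C * C" for n w
    using b_nonneg[of "Suc n" w] b_le[of "Suc n" w] D_le[of w] by simp
  obtain r :: "nat \<Rightarrow> nat" where r: "strict_mono r" "\<And>w. \<exists>l. (\<lambda>n. b (Suc (r n)) w) \<longlonglongrightarrow> l"
    using function_convergent_subsequence[of UNIV "\<lambda>n. b (Suc n)" "C * C * C"] norm by auto
  then obtain l where l: "\<And>w. (\<lambda>n. b (Suc (r n)) w) \<longlonglongrightarrow> l w"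
    by metis
  have vanish: "(\<lambda>n. M / real (Suc (r n))) \<longlonglongrightarrow> 0" for M
  proof -
    have "(\<lambda>n. M / real (Suc n)) \<longlonglongrightarrow> 0"
      using LIMSEQ_Suc[OF lim_const_over_n[of M]] .
    from LIMSEQ_subseq_LIMSEQ[OF this r(1)] show ?thesis
      by (simp add: comp_def)
  qed
  have zero: "x = 0" if "X \<longlonglongrightarrow> x" "\<And>n. \<bar>X n\<bar> \<le> M / real (Suc (r n))" for X x M
  proof -
    have "X \<longlonglongrightarrow> 0"
      by (rule Lim_null_comparison[OF _ vanish[of M]]) (use that(2) in simp)
    with that(1) show ?thesis
      by (rule LIMSEQ_unique)
  qed
  have l_snoc: "(\<Sum>i\<in>UNIV. l (w @ [i])) = l w" for w
  proof -
    have "(\<lambda>n. (\<Sum>i\<in>UNIV. b (Suc (r n)) (w @ [i])) - b (Suc (r n)) w)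
        \<longlonglongrightarrow> (\<Sum>i\<in>UNIV. l (w @ [i])) - l w"
      by (intro tendsto_diff tendsto_sum l)
    from zero[OF this err_snoc] show ?thesis
      by simp
  qed
  have l_Cons: "(\<Sum>i\<in>UNIV. l (i # w)) = l w" for w
  proof -
    have "(\<lambda>n. (\<Sum>i\<in>UNIV. b (Suc (r n)) (i # w)) - b (Suc (r n)) w)
        \<longlonglongrightarrow> (\<Sum>i\<in>UNIV. l (i # w)) - l w"
      by (intro tendsto_diff tendsto_sum l)
    from zero[OF this err_Cons] show ?thesis
      by simp
  qed
  have l_pos: "0 < l w" for w
  proof -
    obtain d where d: "0 < d" "\<And>j k. d \<le> s j k w"
      using s_ge[of w] by auto
    then have "d \<le> l w"
      using b_ge[of "Suc (r _)" d w] by (intro LIMSEQ_le_const[OF l]) auto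
    with d show ?thesis by simp
  qed
  have l_le: "l w \<le> D w" for w
    using b_le[of "Suc (r _)" w] by (intro LIMSEQ_le_const2[OF l]) auto
  show thesis
  proof (rule that[OF L, of "C * C / l []" "\<lambda>w. l w / l []"])
    show "0 < C * C / l []"
      using C l_pos by simp
    show "l w / l [] \<le> C * C / l [] * exp (- real (length w) * L) * N w" for w
      using l_le[of w] l_pos[of "[]"] by (simp add: D_def divide_right_mono field_simps)
    show "0 < l w / l []" for w
      using l_pos by simp
    show "l [] / l [] = 1"
      using l_pos[of "[]"] by simp
    show "(\<Sum>i\<in>UNIV. l (w @ [i]) / l []) = l w / l []" "(\<Sum>i\<in>UNIV. l (i # w) / l []) = l w / l []" for w
      using l_snoc[of w] l_Cons[of w] by (simp_all add: sum_divide_distrib[symmetric])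
  qed
qed

end

section \<open>Measures with prescribed cylinder weights\<close>

text \<open>Consecutive intervals of lengths \<open>q i\<close>, ordered by \<open>to_nat\<close>, tile the interval of length
  \<open>sum q UNIV\<close>.\<close>

lemma interval_subdivision:
  fixes q :: "'m::finite \<Rightarrow> real"
  assumes q: "\<And>i. 0 \<le> q i"
  defines "g \<equiv> \<lambda>i. \<Sum>j | to_nat j < to_nat i. q j"
  shows "0 \<le> g i" "g i + q i \<le> (\<Sum>j\<in>UNIV. q j)"
    and "0 \<le> y \<Longrightarrow> y < (\<Sum>j\<in>UNIV. q j) \<Longrightarrow> \<exists>!i. g i \<le> y \<and> y < g i + q i"
proof -
  have g_add: "g i + q i = (\<Sum>j | to_nat j \<le> to_nat i. q j)" for i
  proof -
    have "{j. to_nat j \<le> to_nat i} = insert i {j. to_nat j < to_nat i}"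
      by (auto simp: le_less)
    then show ?thesis
      by (simp add: g_def)
  qed
  have mono: "sum q X \<le> sum q Y" if "X \<subseteq> Y" for X Y
    using that q by (intro sum_mono2) auto
  show "0 \<le> g i"
    unfolding g_def by (intro sum_nonneg q)
  show "g i + q i \<le> (\<Sum>j\<in>UNIV. q j)"
    unfolding g_add by (rule mono) simp
  assume y: "0 \<le> y" "y < (\<Sum>j\<in>UNIV. q j)"
  define G where "G = {i. y < g i + q i}"
  have "G \<noteq> {}"
  proof -
    have "Max (range (to_nat :: 'm \<Rightarrow> nat)) \<in> range (to_nat :: 'm \<Rightarrow> nat)"
      by (rule Max_in) auto
    then obtain i :: 'm where i: "to_nat i = Max (range (to_nat :: 'm \<Rightarrow> nat))"
      by (metis rangeE)
    have "to_nat j \<le> to_nat i" for j :: 'm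
      unfolding i by (rule Max_ge) auto
    then have "{j :: 'm. to_nat j \<le> to_nat i} = UNIV"
      by auto
    then have "i \<in> G"
      using y unfolding G_def g_add by simp
    then show ?thesis by blast
  qed
  then obtain i where i: "i \<in> G" "\<And>j. j \<in> G \<Longrightarrow> to_nat i \<le> to_nat j"
    using ex_has_least_nat[of "\<lambda>i. i \<in> G" _ to_nat] by blast
  have "g i \<le> y"
  proof (cases "{j :: 'm. to_nat j < to_nat i} = {}")
    case True
    then show ?thesis
      using y by (simp only: g_def) simp
  next
    case False
    then obtain j :: 'm where j: "to_nat j < to_nat i"
      "\<And>j' :: 'm. to_nat j' < to_nat i \<Longrightarrow> to_nat j' \<le> to_nat j"
    proof -
      let ?X = "to_nat ` {j :: 'm. to_nat j < to_nat i}"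
      have "Max ?X \<in> ?X"
        using False by (intro Max_in) auto
      then obtain j :: 'm where j: "to_nat j < to_nat i" "to_nat j = Max ?X"
        by (metis (mono_tags, lifting) imageE mem_Collect_eq)
      have "to_nat j' \<le> to_nat j" if "to_nat j' < to_nat i" for j' :: 'm
        unfolding j(2) using that by (intro Max_ge) auto
      with j(1) show thesis
        by (rule that)
    qed
    then have "{j' :: 'm. to_nat j' < to_nat i} = {j'. to_nat j' \<le> to_nat j}"
      by auto
    then have "g i = g j + q j"
      unfolding g_add by (simp only: g_def)
    moreover have "j \<notin> G"
      using i(2)[of j] j(1) by auto
    ultimately show ?thesis
      by (simp add: G_def)
  qed
  moreover have "i' = i" if "g i' \<le> y" "y < g i' + q i'" "g i \<le> y" "y < g i + q i" for i i'
  proof -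
    have "\<not> to_nat a < to_nat b" if "g b \<le> y" "y < g a + q a" for a b
    proof
      assume "to_nat a < to_nat b"
      then have "g a + q a \<le> g b"
        unfolding g_add unfolding g_def by (intro mono) auto
      with that show False by linarith
    qed
    then have "to_nat i' = to_nat i"
      using that by (meson linorder_neqE_nat)
    then show ?thesis by simp
  qed
  ultimately show "\<exists>!i. g i \<le> y \<and> y < g i + q i"
    using i(1) unfolding G_def by blast
qed

text \<open>Subdivide \<open>[0, 1)\<close> successively into intervals \<open>I w\<close> of length \<open>p w\<close>, with the intervals of the
  extensions \<open>w @ [i]\<close> side by side inside \<open>I w\<close>. Reading off the nested intervals that contain a
  point codes it by a sequence of letters, and the image of Lebesgue measure under this coding has
  the prescribed weights.\<close>

lemma cylinder_weights_measure:
  fixes p :: "'m::finite list \<Rightarrow> real"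
  assumes nonneg: "\<And>w. 0 \<le> p w" and Nil: "p [] = 1"
    and snoc: "\<And>w. (\<Sum>i\<in>UNIV. p (w @ [i])) = p w"
  obtains \<nu> where "sets \<nu> = sets shift_borel" "prob_space \<nu>"
    "\<And>w. measure \<nu> (cylinder w) = p w"
proof -
  define left where "left w = (\<Sum>k<length w. \<Sum>j | to_nat j < to_nat (w ! k). p (take k w @ [j]))" for w
  define I where "I w = {left w ..< left w + p w}" for w
  have left_snoc: "left (w @ [i]) = left w + (\<Sum>j | to_nat j < to_nat i. p (w @ [j]))" for w i
    by (simp add: left_def nth_append)
  have I_snoc: "x \<in> I (w @ [i]) \<longleftrightarrow> (\<Sum>j | to_nat j < to_nat i. p (w @ [j])) \<le> x - left w
      \<and> x - left w < (\<Sum>j | to_nat j < to_nat i. p (w @ [j])) + p (w @ [i])" for x w i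
    by (auto simp: I_def left_snoc)
  have I_sub: "I (w @ [i]) \<subseteq> I w" for w i
  proof
    fix x assume "x \<in> I (w @ [i])"
    then show "x \<in> I w"
      using interval_subdivision(1,2)[of "\<lambda>j. p (w @ [j])" i, OF nonneg]
      unfolding I_snoc snoc by (auto simp: I_def)
  qed
  have I_ex1: "\<exists>!i. x \<in> I (w @ [i])" if "x \<in> I w" for x w
    using interval_subdivision(3)[of "\<lambda>j. p (w @ [j])" "x - left w", OF nonneg] that
    unfolding I_snoc snoc by (auto simp: I_def)
  define code where "code x = rec_nat [] (\<lambda>_ w. w @ [THE i. x \<in> I (w @ [i])])" for x
  have code_0: "code x 0 = []" and code_Suc: "code x (Suc n) = code x n @ [THE i. x \<in> I (code x n @ [i])]"
    for x n
    by (simp_all add: code_def)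
  define digits where "digits x n = (THE i. x \<in> I (code x n @ [i]))" for x n
  have initial: "initial_word n (digits x) = code x n" for x n
    by (induction n) (simp_all add: initial_word_Suc code_Suc code_0 digits_def, simp add: initial_word_def)
  have I_Nil: "I [] = {0..<1}"
    by (simp add: I_def left_def Nil)
  have code_in: "x \<in> I (code x n)" if "x \<in> I []" for x n
  proof (induction n)
    case 0
    then show ?case using that by (simp add: code_0)
  next
    case (Suc n)
    show ?case
      unfolding code_Suc using theI'[OF I_ex1[OF Suc]] .
  qed
  have code_eq: "code x (length w) = w" if "x \<in> I w" for x w
    using that
  proof (induction w rule: rev_induct)
    case (snoc i w)
    then have w: "x \<in> I w"
      using I_sub by blast
    have "(THE i. x \<in> I (w @ [i])) = i"
      by (rule the1_equality[OF I_ex1[OF w]]) (rule snoc.prems)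
    then show ?case
      using snoc.IH[OF w] by (simp add: code_Suc)
  qed (simp add: code_0)
  have I_sub_Nil: "I w \<subseteq> I []" for w
    by (induction w rule: rev_induct) (use I_sub in blast)+
  have vimage: "digits -` cylinder w \<inter> {0..<1} = I w" for w
  proof
    show "digits -` cylinder w \<inter> {0..<1} \<subseteq> I w"
    proof
      fix x assume x: "x \<in> digits -` cylinder w \<inter> {0..<1}"
      then have "code x (length w) = w"
        by (simp add: mem_cylinder_iff initial)
      then show "x \<in> I w"
        using code_in[of x "length w"] x by (simp add: I_Nil)
    qed
    show "I w \<subseteq> digits -` cylinder w \<inter> {0..<1}"
    proof
      fix x assume x: "x \<in> I w"
      then have "x \<in> {0..<1}"
        using I_sub_Nil[of w] unfolding I_Nil by (rule_tac subsetD)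
      then show "x \<in> digits -` cylinder w \<inter> {0..<1}"
        using code_eq[OF x] by (simp add: mem_cylinder_iff initial)
    qed
  qed
  let ?M = "restrict_space lborel {0..<1 :: real}"
  have spM: "space ?M = {0..<1}"
    by (simp add: space_restrict_space)
  have I_sets: "I w \<in> sets ?M" for w
    using I_sub_Nil[of w] unfolding I_Nil
    by (subst sets_restrict_space_iff) (auto simp: I_def)
  interpret M: prob_space ?M
    by (rule prob_spaceI) (simp add: spM emeasure_restrict_space)
  have meas: "digits \<in> measurable ?M shift_borel"
  proof (rule measurable_sigma_sets[OF sets_shift_borel])
    fix y assume "y \<in> range (cylinder :: 'm list \<Rightarrow> _)"
    then obtain w where "y = cylinder w" by auto
    then show "digits -` y \<inter> space ?M \<in> sets ?M"
      using vimage[of w] I_sets[of w] by (simp only: spM)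
  qed auto
  show thesis
  proof (rule that[of "distr ?M shift_borel digits"])
    show "prob_space (distr ?M shift_borel digits)"
      by (rule M.prob_space_distr[OF meas])
    show "measure (distr ?M shift_borel digits) (cylinder w) = p w" for w
    proof -
      have "measure (distr ?M shift_borel digits) (cylinder w) = measure ?M (I w)"
        by (subst measure_distr[OF meas cylinder_in_sets]) (simp only: spM vimage)
      also have "\<dots> = measure lborel (I w)"
        using I_sub_Nil[of w] unfolding I_Nil by (intro measure_restrict_space) auto
      also have "\<dots> = p w"
        using nonneg[of w] by (simp add: I_def)
      finally show ?thesis .
    qed
  qed simp
qed

text \<open>The preimage of a cylinder under the shift is the union of the cylinders that put one letter in
  front of its word.\<close>

lemma invariant_measure_of_weights:
  fixes p :: "'m::finite list \<Rightarrow> real"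
  assumes nonneg: "\<And>w. 0 \<le> p w" and Nil: "p [] = 1"
    and snoc: "\<And>w. (\<Sum>i\<in>UNIV. p (w @ [i])) = p w"
    and Cons: "\<And>w. (\<Sum>i\<in>UNIV. p (i # w)) = p w"
  obtains \<nu> where "\<nu> \<in> invariant_measures" "\<And>w. measure \<nu> (cylinder w) = p w"
proof -
  obtain \<nu> where s: "sets \<nu> = sets shift_borel" and p: "prob_space \<nu>"
    and m: "\<And>w. measure \<nu> (cylinder w) = p w"
    by (rule cylinder_weights_measure[OF nonneg Nil snoc]) blast
  interpret prob_space \<nu> by (rule p)
  have sp: "space \<nu> = UNIV"
    using sets_eq_imp_space_eq[OF s] by simp
  have cyl: "cylinder w \<in> sets \<nu>" for w
    by (simp add: s cylinder_in_sets)
  have T: "shift \<in> measurable \<nu> \<nu>"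
    using measurable_shift measurable_cong_sets[OF s s] by blast
  have "distr \<nu> \<nu> shift = \<nu>"
  proof (rule shift_measure_eqI)
    show "finite_measure (distr \<nu> \<nu> shift)"
      using prob_space_distr[OF T] by (simp add: prob_space_def)
    fix w :: "'m list"
    have "initial_word (Suc n) x = x 0 # initial_word n (shift x)" for n and x :: "nat \<Rightarrow> 'm"
      using initial_word_add[of 1 n x] by (simp add: initial_word_def)
    then have v: "shift -` cylinder w = (\<Union>i. cylinder (i # w))"
      by (auto simp: mem_cylinder_iff)
    have "disjoint_family (\<lambda>i. cylinder (i # w))"
      by (auto simp: disjoint_family_on_def mem_cylinder_iff)
    then have "measure \<nu> (shift -` cylinder w) = (\<Sum>i\<in>UNIV. measure \<nu> (cylinder (i # w)))"
      unfolding v using cyl by (intro finite_measure_finite_Union) auto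
    also have "\<dots> = measure \<nu> (cylinder w)"
      by (simp add: m Cons)
    finally have "emeasure \<nu> (shift -` cylinder w) = emeasure \<nu> (cylinder w)"
      by (simp add: emeasure_eq_measure)
    then show "emeasure (distr \<nu> \<nu> shift) (cylinder w) = emeasure \<nu> (cylinder w)"
      using emeasure_distr[OF T cyl] by (simp add: sp)
  qed (simp_all add: s)
  then have "\<nu> \<in> invariant_measures"
    by (simp add: invariant_measures_def s p)
  then show thesis
    using m by (rule that)
qed

section \<open>Products of an irreducible tuple of matrices\<close>

text \<open>Later letters multiply on the left, as they do in \<^const>\<open>cocycle\<close>.\<close>

fun word_product :: "('m \<Rightarrow> real ^ 'd ^ 'd) \<Rightarrow> 'm list \<Rightarrow> real ^ 'd ^ 'd" where
  "word_product A [] = mat 1"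
| "word_product A (i # w) = word_product A w ** A i"

lemma word_product_append: "word_product A (u @ v) = word_product A v ** word_product A u"
  by (induction u) (simp_all add: matrix_mul_assoc)

lemma cocycle_eq_word_product: "cocycle A x n = word_product A (initial_word n x)"
  by (induction n) (simp_all add: initial_word_Suc word_product_append, simp add: initial_word_def)

lemma word_product_in_semigroup: "w \<noteq> [] \<Longrightarrow> word_product A w \<in> generated_semigroup A"
proof (induction w)
  case (Cons i w)
  then show ?case
    by (cases "w = []") (auto intro: generated_semigroup.intros)
qed simp

lemma semigroup_eq_word_product:
  "B \<in> generated_semigroup A \<Longrightarrow> \<exists>w. w \<noteq> [] \<and> word_product A w = B"
proof (induction rule: generated_semigroup.induct)
  case (gen i)
  show ?case by (rule exI[of _ "[i]"]) simp
next
  case (mult B C)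
  then obtain u v where "u \<noteq> []" "word_product A u = B" "word_product A v = C"
    by blast
  then show ?case
    by (intro exI[of _ "v @ u"]) (simp add: word_product_append)
qed

lemma op_norm_bounded_linear: "bounded_linear (\<lambda>v. B *v v)" for B :: "real ^ 'd ^ 'd"
  by (rule matrix_vector_mul_bounded_linear)

lemma op_norm_nonneg: "0 \<le> op_norm B"
  unfolding op_norm_def by (rule onorm_pos_le[OF op_norm_bounded_linear])

lemma norm_le_op_norm: "norm (B *v v) \<le> op_norm B * norm v"
  unfolding op_norm_def by (rule onorm[OF op_norm_bounded_linear])

lemma op_norm_mult_le: "op_norm (B ** C) \<le> op_norm B * op_norm C"
  using onorm_compose[OF op_norm_bounded_linear[of B] op_norm_bounded_linear[of C]]
  by (simp add: op_norm_def comp_def matrix_vector_mul_assoc)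

lemma op_norm_eq_0_iff: "op_norm B = 0 \<longleftrightarrow> B = 0"
proof -
  have "op_norm B = 0 \<longleftrightarrow> (\<forall>v. B *v v = 0)"
    unfolding op_norm_def by (rule onorm_eq_0[OF op_norm_bounded_linear])
  also have "\<dots> \<longleftrightarrow> B = 0"
    by (metis matrix_eq matrix_vector_mult_0)
  finally show ?thesis .
qed

lemma nearly_norming_vector:
  assumes "0 < op_norm B"
  obtains v where "op_norm B / 2 * norm v < norm (B *v v)"
proof -
  have "\<not> (\<forall>v. norm (B *v v) \<le> op_norm B / 2 * norm v)"
    using onorm_le[of "\<lambda>v. B *v v" "op_norm B / 2"] assms by (auto simp: op_norm_def)
  then show thesis
    using that by (auto simp: not_le)
qed

text \<open>The orbit of \<open>a\<close> spans a nonzero invariant subspace, which is the whole space; hence \<open>b\<close> cannot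
  be orthogonal to the orbit.\<close>

lemma irreducible_orbit_spans:
  fixes A :: "'m::finite \<Rightarrow> real ^ 'd ^ 'd"
  assumes irr: "irreducible_tuple A" and "a \<noteq> 0" "b \<noteq> 0"
  shows "\<exists>w. b \<bullet> (word_product A w *v a) \<noteq> 0"
proof (rule ccontr)
  assume "\<not> ?thesis"
  then have orth: "b \<bullet> (word_product A w *v a) = 0" for w by blast
  define G where "G = range (\<lambda>w. word_product A w *v a)"
  have a: "a \<in> span G"
    by (rule span_base) (auto simp: G_def intro!: image_eqI[of _ _ "[]"])
  have "(\<lambda>v. A i *v v) ` span G \<subseteq> span G" for i
  proof -
    have "(\<lambda>v. A i *v v) ` G \<subseteq> G"
    proof
      fix v assume "v \<in> (\<lambda>v. A i *v v) ` G"
      then obtain w where "v = A i *v (word_product A w *v a)"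
        by (auto simp: G_def)
      then have "v = word_product A (w @ [i]) *v a"
        by (simp add: word_product_append matrix_vector_mul_assoc)
      then show "v \<in> G"
        by (simp add: G_def)
    qed
    then have "span ((\<lambda>v. A i *v v) ` G) \<subseteq> span G"
      by (rule span_mono)
    then show ?thesis
      by (simp add: linear_span_image[OF matrix_vector_mul_linear])
  qed
  moreover have "0 < dim (span G)"
  proof (rule ccontr)
    assume "\<not> 0 < dim (span G)"
    then have "span G \<subseteq> {0}"
      by (simp only: not_gr_zero dim_eq_0)
    with a \<open>a \<noteq> 0\<close> show False by blast
  qed
  ultimately have "\<not> dim (span G) < CARD('d)"
    using irr unfolding irreducible_tuple_def by (metis subspace_span)
  then have "dim G = DIM(real ^ 'd)"
    using dim_subset_UNIV[of G] by simp
  then have "span G = UNIV"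
    by (simp only: dim_eq_full)
  moreover have "b \<bullet> x = 0" if "x \<in> span G" for x
    using that
  proof (induction rule: span_induct_alt)
    case (step c x y)
    then show ?case
      using orth by (auto simp: G_def inner_add_right)
  qed simp
  ultimately have "b \<bullet> b = 0"
    by blast
  with \<open>b \<noteq> 0\<close> show False by simp
qed

text \<open>Compactness of the product of two unit spheres reduces the choice of the word to finitely many
  words and makes the lower bound uniform.\<close>

lemma irreducible_uniform_connection:
  fixes A :: "'m::finite \<Rightarrow> real ^ 'd ^ 'd"
  assumes irr: "irreducible_tuple A"
  obtains K c where "finite K" "0 < c"
    "\<And>a b. \<exists>w\<in>K. c * (norm a * norm b) \<le> \<bar>b \<bullet> (word_product A w *v a)\<bar>"
proof -
  let ?S = "sphere (0 :: real ^ 'd) 1 \<times> sphere (0 :: real ^ 'd) 1"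
  let ?f = "\<lambda>w (z :: (real ^ 'd) \<times> (real ^ 'd)). snd z \<bullet> (word_product A w *v fst z)"
  have cont: "continuous_on T (?f w)" for T w
    by (intro continuous_intros bounded_linear.continuous_on[OF op_norm_bounded_linear])
  have comp: "compact ?S"
    by (intro compact_Times) auto
  have "\<exists>K\<subseteq>UNIV. finite K \<and> ?S \<subseteq> (\<Union>w\<in>K. {z. ?f w z \<noteq> 0})"
  proof (rule compactE_image[OF comp, of UNIV "\<lambda>w. {z. ?f w z \<noteq> 0}"])
    show "open {z. ?f w z \<noteq> 0}" for w
      by (intro open_Collect_neq cont continuous_on_const)
    show "?S \<subseteq> (\<Union>w\<in>UNIV. {z. ?f w z \<noteq> 0})"
    proof
      fix z assume "z \<in> ?S"
      then have "fst z \<noteq> 0" "snd z \<noteq> 0" by auto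
      then show "z \<in> (\<Union>w\<in>UNIV. {z. ?f w z \<noteq> 0})"
        using irreducible_orbit_spans[OF irr] by auto
    qed
  qed blast
  then obtain K where K: "finite K" "?S \<subseteq> (\<Union>w\<in>K. {z. ?f w z \<noteq> 0})"
    by blast
  define g where "g z = (\<Sum>w\<in>K. \<bar>?f w z\<bar>)" for z
  have "?S \<noteq> {}"
    using norm_axis_1 by (auto simp: ex_in_conv[symmetric])
  moreover have "continuous_on ?S g"
    unfolding g_def by (intro continuous_intros cont)
  ultimately obtain z0 where z0: "z0 \<in> ?S" "\<And>z. z \<in> ?S \<Longrightarrow> g z0 \<le> g z"
    using continuous_attains_inf[OF comp] by blast
  have "0 < g z0"
  proof -
    obtain w where w: "w \<in> K" "?f w z0 \<noteq> 0"
      using K(2) z0(1) by blast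
    have "\<bar>?f w z0\<bar> \<le> g z0"
      unfolding g_def using K(1) w(1) by (intro member_le_sum) auto
    with w show ?thesis by linarith
  qed
  have "K \<noteq> {}"
    using K(2) z0(1) by blast
  then have card: "0 < real (card K)"
    using K(1) by (simp add: card_gt_0_iff)
  let ?c = "g z0 / real (card K)"
  have unit: "\<exists>w\<in>K. ?c \<le> \<bar>?f w z\<bar>" if "z \<in> ?S" for z
  proof (rule ccontr)
    assume "\<not> ?thesis"
    then have "g z < (\<Sum>w\<in>K. ?c)"
      unfolding g_def using K(1) \<open>K \<noteq> {}\<close> by (intro sum_strict_mono) (auto simp: not_le)
    also have "\<dots> = g z0"
      using card by simp
    finally show False
      using z0(2)[OF that] by simp
  qed
  have all: "\<exists>w\<in>K. ?c * (norm a * norm b) \<le> \<bar>b \<bullet> (word_product A w *v a)\<bar>" for a b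
  proof (cases "a = 0 \<or> b = 0")
    case True
    then show ?thesis
      using \<open>K \<noteq> {}\<close> by auto
  next
    case False
    then have "(a /\<^sub>R norm a, b /\<^sub>R norm b) \<in> ?S"
      by simp
    then obtain w where w: "w \<in> K" "?c \<le> \<bar>?f w (a /\<^sub>R norm a, b /\<^sub>R norm b)\<bar>"
      using unit by blast
    have E: "\<bar>?f w (a /\<^sub>R norm a, b /\<^sub>R norm b)\<bar> = \<bar>b \<bullet> (word_product A w *v a)\<bar> / (norm a * norm b)"
      by (simp add: linear_scale[OF matrix_vector_mul_linear] abs_mult divide_inverse)
    have "0 < norm a * norm b"
      using False by simp
    then have "?c * (norm a * norm b) \<le> \<bar>b \<bullet> (word_product A w *v a)\<bar>"
      using w(2) unfolding E by (simp only: pos_le_divide_eq)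
    with w(1) show ?thesis
      by blast
  qed
  show thesis
    using card \<open>0 < g z0\<close> by (intro that[OF K(1) _ all]) simp
qed

text \<open>Connect a direction \<open>C *v x\<close> in which \<open>C\<close> nearly attains its norm to the covector
  \<open>(B *v z) v* B\<close>, whose length is comparable to \<open>op_norm B * norm (B *v z)\<close>. The factor \<open>1 / 4\<close> comes
  from attaining each norm only up to a factor \<open>1 / 2\<close>.\<close>

lemma irreducible_quasi_multiplicative:
  fixes A :: "'m::finite \<Rightarrow> real ^ 'd ^ 'd"
  assumes irr: "irreducible_tuple A"
  obtains K c where "finite K" "0 < c"
    "\<And>B C. \<exists>w\<in>K. c * (op_norm B * op_norm C) \<le> op_norm (B ** word_product A w ** C)"
proof -
  obtain K c where K: "finite K" and c: "0 < c"
    and conn: "\<And>a b. \<exists>w\<in>K. c * (norm a * norm b) \<le> \<bar>b \<bullet> (word_product A w *v a)\<bar>"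
    using irreducible_uniform_connection[OF irr] by metis
  have "\<exists>w\<in>K. c / 4 * (op_norm B * op_norm C) \<le> op_norm (B ** word_product A w ** C)" for B C
  proof (cases "op_norm B = 0 \<or> op_norm C = 0")
    case True
    obtain w where "w \<in> K"
      using conn by blast
    with True show ?thesis
      by (intro bexI[of _ w]) (auto simp: op_norm_nonneg)
  next
    case False
    then have pos: "0 < op_norm B" "0 < op_norm C"
      using op_norm_nonneg[of B] op_norm_nonneg[of C] by auto
    obtain z where z: "op_norm B / 2 * norm z < norm (B *v z)"
      using nearly_norming_vector[OF pos(1)] .
    obtain x where x: "op_norm C / 2 * norm x < norm (C *v x)"
      using nearly_norming_vector[OF pos(2)] .
    have z0: "0 < norm z" and x0: "0 < norm x"
      using z x by (auto simp: zero_less_norm_iff)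
    let ?y = "B *v z"
    define b where "b = ?y v* B"
    have y0: "0 < norm ?y"
      using z pos z0 by (smt (verit) mult_nonneg_nonneg norm_ge_zero divide_nonneg_nonneg)
    obtain w where w: "w \<in> K" "c * (norm (C *v x) * norm b) \<le> \<bar>b \<bullet> (word_product A w *v (C *v x))\<bar>"
      using conn by blast
    have bz: "norm ?y * norm ?y \<le> norm b * norm z"
    proof -
      have "norm ?y * norm ?y = b \<bullet> z"
        unfolding b_def dot_lmul_matrix by (simp add: power2_norm_eq_inner[symmetric] power2_eq_square)
      also have "\<dots> \<le> norm b * norm z"
        by (rule norm_cauchy_schwarz)
      finally show ?thesis .
    qed
    have "op_norm B / 2 * norm z * norm ?y \<le> norm b * norm z"
      using bz z mult_right_mono[of "op_norm B / 2 * norm z" "norm ?y" "norm ?y"] by simp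
    then have b: "op_norm B / 2 * norm ?y \<le> norm b"
      using z0 by (simp add: field_simps)
    have "\<bar>b \<bullet> (word_product A w *v (C *v x))\<bar> = \<bar>?y \<bullet> ((B ** word_product A w ** C) *v x)\<bar>"
      unfolding b_def dot_lmul_matrix by (simp add: matrix_vector_mul_assoc matrix_mul_assoc)
    also have "\<dots> \<le> norm ?y * norm ((B ** word_product A w ** C) *v x)"
      by (rule Cauchy_Schwarz_ineq2)
    also have "\<dots> \<le> norm ?y * (op_norm (B ** word_product A w ** C) * norm x)"
      by (intro mult_left_mono norm_le_op_norm) simp
    finally have upper: "c * (norm (C *v x) * norm b)
        \<le> norm ?y * (op_norm (B ** word_product A w ** C) * norm x)"
      using w(2) by linarith
    have "c * ((op_norm C / 2 * norm x) * (op_norm B / 2 * norm ?y)) \<le> c * (norm (C *v x) * norm b)"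
      using c x b pos by (intro mult_left_mono mult_mono) auto
    with upper have "(c / 4 * (op_norm B * op_norm C)) * (norm x * norm ?y)
        \<le> op_norm (B ** word_product A w ** C) * (norm x * norm ?y)"
      by (simp add: ac_simps)
    then have "c / 4 * (op_norm B * op_norm C) \<le> op_norm (B ** word_product A w ** C)"
      using x0 y0 by (simp only: mult_le_cancel_right_pos mult_pos_pos)
    with w(1) show ?thesis by blast
  qed
  then show thesis
    using K c by (intro that[of K "c / 4"]) auto
qed

lemma irreducible_norm_potential:
  fixes A :: "'m::finite \<Rightarrow> real ^ 'd ^ 'd"
  assumes irr: "irreducible_tuple A" and nz: "\<And>w. word_product A w \<noteq> 0" and s: "0 < s"
  shows "quasi_multiplicative (\<lambda>w. op_norm (word_product A w) powr s)"
proof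
  have pos: "0 < op_norm (word_product A w)" for w
    using op_norm_nonneg[of "word_product A w"] op_norm_eq_0_iff nz by (metis less_le)
  show "0 < op_norm (word_product A w) powr s" for w
    using pos[of w] by simp
  show "op_norm (word_product A (u @ v)) powr s
      \<le> op_norm (word_product A u) powr s * op_norm (word_product A v) powr s" for u v
  proof -
    have "op_norm (word_product A (u @ v)) powr s
        \<le> (op_norm (word_product A v) * op_norm (word_product A u)) powr s"
      unfolding word_product_append using s by (intro powr_mono2 op_norm_mult_le op_norm_nonneg) auto
    also have "\<dots> = op_norm (word_product A u) powr s * op_norm (word_product A v) powr s"
      by (simp add: powr_mult op_norm_nonneg)
    finally show ?thesis .
  qed
  obtain K c where K: "finite K" and c: "0 < c"
    and q: "\<And>B C. \<exists>w\<in>K. c * (op_norm B * op_norm C) \<le> op_norm (B ** word_product A w ** C)"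
    using irreducible_quasi_multiplicative[OF irr] by metis
  have "\<exists>\<kappa>\<in>K. c powr s * (op_norm (word_product A u) powr s * op_norm (word_product A v) powr s)
      \<le> op_norm (word_product A (u @ \<kappa> @ v)) powr s" for u v
  proof -
    obtain \<kappa> where k: "\<kappa> \<in> K" "c * (op_norm (word_product A v) * op_norm (word_product A u))
        \<le> op_norm (word_product A v ** word_product A \<kappa> ** word_product A u)"
      using q by blast
    have "c powr s * (op_norm (word_product A u) powr s * op_norm (word_product A v) powr s)
        = (c * (op_norm (word_product A v) * op_norm (word_product A u))) powr s"
      using c by (simp add: powr_mult op_norm_nonneg)
    also have "\<dots> \<le> op_norm (word_product A (u @ \<kappa> @ v)) powr s"
      unfolding word_product_append using s c k(2)
      by (intro powr_mono2 mult_nonneg_nonneg op_norm_nonneg) auto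
    finally show ?thesis
      using k(1) by blast
  qed
  then show "\<exists>K c. finite K \<and> 0 < c \<and> (\<forall>u v. \<exists>\<kappa>\<in>K.
      c * (op_norm (word_product A u) powr s * op_norm (word_product A v) powr s)
        \<le> op_norm (word_product A (u @ \<kappa> @ v)) powr s)"
    using K c by (intro exI[of _ K] exI[of _ "c powr s"]) simp
qed

section \<open>Free energy of an invariant measure\<close>

lemma invariant_measuresD:
  assumes "\<nu> \<in> invariant_measures"
  shows "sets \<nu> = sets shift_borel" "prob_space \<nu>" "space \<nu> = UNIV"
    "cylinder w \<in> sets (\<nu> :: (nat \<Rightarrow> 'm::finite) measure)"
  using assms sets_eq_imp_space_eq[of \<nu> shift_borel] cylinder_in_sets
  by (auto simp: invariant_measures_def)

lemma sum_cylinder_measures: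
  fixes \<nu> :: "(nat \<Rightarrow> 'm::finite) measure"
  assumes "\<nu> \<in> invariant_measures"
  shows "(\<Sum>w\<in>words n. measure \<nu> (cylinder w)) = 1"
proof -
  note \<nu> = invariant_measuresD[OF assms]
  interpret prob_space \<nu> by (rule \<nu>(2))
  have "measure \<nu> UNIV = (\<Sum>w\<in>words n. measure \<nu> (initial_word n -` {w}))"
    using measure_fibre_sum[OF simple_function_initial_word[OF \<nu>(1)], of UNIV n] sets.top[of \<nu>]
    by (simp add: \<nu>(3) initial_word_image)
  also have "\<dots> = (\<Sum>w\<in>words n. measure \<nu> (cylinder w))"
    by (intro sum.cong refl) (simp add: initial_word_vimage words_def)
  finally show ?thesis
    using prob_space by (simp add: \<nu>(3))
qed

lemma shannon_initial_word:
  fixes \<nu> :: "(nat \<Rightarrow> 'm::finite) measure"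
  assumes "\<nu> \<in> invariant_measures"
  shows "shannon \<nu> (initial_word n)
    = - (\<Sum>w\<in>words n. measure \<nu> (cylinder w) * ln (measure \<nu> (cylinder w)))"
  unfolding shannon_def invariant_measuresD(3)[OF assms] initial_word_image
  by (intro arg_cong[where f = uminus] sum.cong refl) (simp add: initial_word_vimage words_def)

lemma integral_word_function:
  fixes \<nu> :: "(nat \<Rightarrow> 'm::finite) measure" and f :: "'m list \<Rightarrow> real"
  assumes "\<nu> \<in> invariant_measures"
  shows "integrable \<nu> (\<lambda>x. f (initial_word n x))"
    and "(\<integral>x. f (initial_word n x) \<partial>\<nu>) = (\<Sum>w\<in>words n. measure \<nu> (cylinder w) * f w)"
proof -
  note \<nu> = invariant_measuresD[OF assms]
  interpret prob_space \<nu> by (rule \<nu>(2))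
  have eq: "f (initial_word n x) = (\<Sum>w\<in>words n. f w * indicator (cylinder w) x)" for x
  proof -
    have in_words: "initial_word n x \<in> words n"
      by (simp add: words_def)
    have "(\<Sum>w\<in>words n. f w * indicator (cylinder w) x)
        = (\<Sum>w\<in>words n. if w = initial_word n x then f w else 0)"
      by (intro sum.cong refl) (auto simp: words_def mem_cylinder_iff split: split_indicator)
    also have "\<dots> = f (initial_word n x)"
      using in_words by simp
    finally show ?thesis by simp
  qed
  have int: "integrable \<nu> (\<lambda>x. f w * indicator (cylinder w) x)" for w
    using \<nu>(4)[of w] by (intro integrable_mult_right integrable_real_indicator)
      (auto simp: emeasure_eq_measure)
  show "integrable \<nu> (\<lambda>x. f (initial_word n x))"
    unfolding eq by (intro Bochner_Integration.integrable_sum int)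
  have "(\<integral>x. f (initial_word n x) \<partial>\<nu>) = (\<Sum>w\<in>words n. \<integral>x. f w * indicator (cylinder w) x \<partial>\<nu>)"
    unfolding eq by (intro Bochner_Integration.integral_sum int)
  also have "\<dots> = (\<Sum>w\<in>words n. measure \<nu> (cylinder w) * f w)"
    by (intro sum.cong refl) (simp add: \<nu>(3) mult.commute)
  finally show "(\<integral>x. f (initial_word n x) \<partial>\<nu>) = (\<Sum>w\<in>words n. measure \<nu> (cylinder w) * f w)" .
qed

lemma extended_integral_real:
  assumes "integrable M g"
  shows "extended_integral M (\<lambda>x. ereal (g x)) = ereal (\<integral>x. g x \<partial>M)"
proof -
  have fin: "(\<integral>\<^sup>+x. ennreal (g x) \<partial>M) \<noteq> \<infinity>" "(\<integral>\<^sup>+x. ennreal (- g x) \<partial>M) \<noteq> \<infinity>"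
    using assms by (auto simp: real_integrable_def)
  then have "enn2ereal (\<integral>\<^sup>+x. ennreal (g x) \<partial>M) = ereal (enn2real (\<integral>\<^sup>+x. ennreal (g x) \<partial>M))"
    "enn2ereal (\<integral>\<^sup>+x. ennreal (- g x) \<partial>M) = ereal (enn2real (\<integral>\<^sup>+x. ennreal (- g x) \<partial>M))"
    by (metis enn2ereal_ennreal enn2real_nonneg ennreal_enn2real infinity_ennreal_def top.not_eq_extremum)+
  then show ?thesis
    unfolding extended_integral_def
    by (simp add: real_lebesgue_integral_def[OF assms] flip: ennreal.abs_eq)
qed

text \<open>The integral of \<open>ln \<parallel>cocycle A x n\<parallel>\<close> as a finite sum; it has this meaning when no product vanishes,
  since \<open>ln 0 = 0\<close> for the real logarithm.\<close>

definition mean_log_norm ::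
    "('m \<Rightarrow> real ^ 'd ^ 'd) \<Rightarrow> (nat \<Rightarrow> 'm) measure \<Rightarrow> nat \<Rightarrow> real" where
  "mean_log_norm A \<nu> n =
    (\<Sum>w\<in>words n. measure \<nu> (cylinder w) * ln (op_norm (word_product A w)))"

lemma op_norm_pos: "B \<noteq> 0 \<Longrightarrow> 0 < op_norm B"
  using op_norm_nonneg[of B] op_norm_eq_0_iff[of B] by linarith

lemma lyapunov_exponent_tendsto:
  fixes A :: "'m::finite \<Rightarrow> real ^ 'd ^ 'd"
  assumes \<nu>: "\<nu> \<in> invariant_measures" and nz: "\<And>w. word_product A w \<noteq> 0"
  shows "(\<lambda>n. ereal (mean_log_norm A \<nu> n / real n)) \<longlonglongrightarrow> lyapunov_exponent A \<nu>"
proof -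
  interpret measure_preserving \<nu> shift
    by (rule invariant_measures_measure_preserving[OF \<nu>])
  let ?f = "\<lambda>w. ln (op_norm (word_product A w))"
  note int = integral_word_function[OF \<nu>, of ?f]
  have G: "mean_log_norm A \<nu> n = (\<integral>x. ?f (initial_word n x) \<partial>\<nu>)" for n
    by (simp add: mean_log_norm_def int(2))
  have sub: "mean_log_norm A \<nu> (m + n) \<le> mean_log_norm A \<nu> m + mean_log_norm A \<nu> n" for m n
  proof -
    interpret Tm: measure_preserving \<nu> "shift ^^ m"
      by (rule measure_preserving_funpow)
    have le: "?f (initial_word (m + n) x)
        \<le> ?f (initial_word m x) + ?f (initial_word n ((shift ^^ m) x))" for x
    proof -
      have "op_norm (word_product A (initial_word (m + n) x))
          \<le> op_norm (word_product A (initial_word n ((shift ^^ m) x)))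
              * op_norm (word_product A (initial_word m x))"
        unfolding initial_word_add word_product_append by (rule op_norm_mult_le)
      then have "ln (op_norm (word_product A (initial_word (m + n) x)))
          \<le> ln (op_norm (word_product A (initial_word n ((shift ^^ m) x)))
              * op_norm (word_product A (initial_word m x)))"
        by (intro ln_mono op_norm_pos nz)
      then show ?thesis
        by (simp add: ln_mult_pos op_norm_pos nz)
    qed
    have I: "integrable \<nu> (\<lambda>x. ?f (initial_word n ((shift ^^ m) x)))"
      using integrable_distr[OF Tm.T_measurable, of "\<lambda>x. ?f (initial_word n x)"] int(1)
      by (simp add: Tm.T_invariant)
    have "(\<integral>x. ?f (initial_word n ((shift ^^ m) x)) \<partial>\<nu>) = (\<integral>x. ?f (initial_word n x) \<partial>distr \<nu> \<nu> (shift ^^ m))"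
      using int(1) by (intro integral_distr[symmetric] Tm.T_measurable) auto
    then have "mean_log_norm A \<nu> m + mean_log_norm A \<nu> n
        = (\<integral>x. ?f (initial_word m x) + ?f (initial_word n ((shift ^^ m) x)) \<partial>\<nu>)"
      unfolding G using int(1) I by (simp add: Tm.T_invariant)
    also have "\<dots> \<ge> mean_log_norm A \<nu> (m + n)"
      unfolding G using int(1) I le by (intro integral_mono) auto
    finally show ?thesis .
  qed
  have "extended_integral \<nu> (\<lambda>x. ereal_ln (op_norm (cocycle A x n))) = ereal (mean_log_norm A \<nu> n)" for n
  proof -
    have "op_norm (word_product A w) \<noteq> 0" for w
      using nz by (simp add: op_norm_eq_0_iff)
    then have "ereal_ln (op_norm (cocycle A x n)) = ereal (?f (initial_word n x))" for x
      by (simp add: ereal_ln_def cocycle_eq_word_product)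
    then show ?thesis
      using extended_integral_real[OF int(1)[of n]] by (simp add: G)
  qed
  then have "lyapunov_exponent A \<nu> = lim (\<lambda>n. ereal (mean_log_norm A \<nu> n / real n))"
    by (simp add: lyapunov_exponent_def)
  then show ?thesis
    using fekete_ereal[OF sub] limI by metis
qed

text \<open>Adding the two limits is legitimate because the metric entropy is finite, while the Lyapunov
  exponent may be \<open>-\<infinity>\<close>.\<close>

lemma free_energy_tendsto:
  fixes A :: "'m::finite \<Rightarrow> real ^ 'd ^ 'd"
  assumes \<nu>: "\<nu> \<in> invariant_measures" and nz: "\<And>w. word_product A w \<noteq> 0"
  shows "(\<lambda>n. ereal ((shannon \<nu> (initial_word n) + s * mean_log_norm A \<nu> n) / real n))
    \<longlonglongrightarrow> free_energy A s \<nu>"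
proof -
  obtain h where h: "metric_entropy \<nu> shift = ereal h"
    "(\<lambda>n. shannon \<nu> (initial_word n) / real n) \<longlonglongrightarrow> h"
    by (rule metric_entropy_shift[OF \<nu>])
  have "(\<lambda>n. ereal (shannon \<nu> (initial_word n) / real n)) \<longlonglongrightarrow> ereal h"
    using h(2) by simp
  moreover have "(\<lambda>n. ereal s * ereal (mean_log_norm A \<nu> n / real n)) \<longlonglongrightarrow> ereal s * lyapunov_exponent A \<nu>"
    by (intro tendsto_cmult_ereal lyapunov_exponent_tendsto[OF \<nu> nz]) simp
  ultimately have "(\<lambda>n. ereal (shannon \<nu> (initial_word n) / real n)
      + ereal s * ereal (mean_log_norm A \<nu> n / real n)) \<longlonglongrightarrow> ereal h + ereal s * lyapunov_exponent A \<nu>"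
    by (intro tendsto_add_ereal_general2) auto
  then show ?thesis
    by (simp add: free_energy_def h(1) add_divide_distrib)
qed

text \<open>The cocycle vanishes on the cylinder of \<open>w\<close> from time \<open>length w\<close> on, so the integral of its
  logarithm is \<open>-\<infinity>\<close>, and a finite entropy cannot compensate this.\<close>

lemma free_energy_zero_word:
  fixes A :: "'m::finite \<Rightarrow> real ^ 'd ^ 'd"
  assumes \<nu>: "\<nu> \<in> invariant_measures" and s: "0 < s"
    and w: "word_product A w = 0" "0 < emeasure \<nu> (cylinder w)"
  shows "free_energy A s \<nu> = - \<infinity>"
proof -
  note D = invariant_measuresD[OF \<nu>]
  interpret prob_space \<nu> by (rule D(2))
  have integral: "extended_integral \<nu> (\<lambda>x. ereal_ln (op_norm (cocycle A x n))) = - \<infinity>"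
    if n: "length w \<le> n" for n
  proof -
    let ?g = "\<lambda>x. ereal_ln (op_norm (cocycle A x n))"
    define B where "B = Max ((\<lambda>v. ln (op_norm (word_product A v))) ` words n)"
    have "e2ennreal (?g x) \<le> ennreal B" for x
    proof (cases "op_norm (cocycle A x n) = 0")
      case True
      then show ?thesis by (simp add: ereal_ln_def e2ennreal_neg)
    next
      case False
      have "ln (op_norm (cocycle A x n)) \<le> B"
        unfolding B_def cocycle_eq_word_product by (rule Max_ge) (auto simp: words_def[of n] finite_words[unfolded words_def])
      with False show ?thesis
        by (simp add: ereal_ln_def ennreal_leI flip: ennreal.abs_eq)
    qed
    then have "(\<integral>\<^sup>+x. e2ennreal (?g x) \<partial>\<nu>) \<le> (\<integral>\<^sup>+x. ennreal B \<partial>\<nu>)"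
      by (intro nn_integral_mono)
    then have "(\<integral>\<^sup>+x. e2ennreal (?g x) \<partial>\<nu>) \<le> ennreal B"
      by (simp add: emeasure_space_1)
    then have pos: "(\<integral>\<^sup>+x. e2ennreal (?g x) \<partial>\<nu>) < \<top>"
      using ennreal_less_top le_less_trans by blast
    have "op_norm (cocycle A x n) = 0" if "x \<in> cylinder w" for x
    proof -
      have "initial_word n x = w @ initial_word (n - length w) ((shift ^^ length w) x)"
        using initial_word_add[of "length w" "n - length w" x] n that by (simp add: mem_cylinder_iff)
      then show ?thesis
        by (simp add: cocycle_eq_word_product word_product_append w(1) op_norm_eq_0_iff)
    qed
    then have "(\<integral>\<^sup>+x. \<infinity> * indicator (cylinder w) x \<partial>\<nu>) \<le> (\<integral>\<^sup>+x. e2ennreal (- ?g x) \<partial>\<nu>)"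
      by (intro nn_integral_mono) (auto simp: ereal_ln_def split: split_indicator)
    moreover have "(\<integral>\<^sup>+x. \<infinity> * indicator (cylinder w) x \<partial>\<nu>) = \<infinity> * emeasure \<nu> (cylinder w)"
      by (rule nn_integral_cmult_indicator[OF D(4)])
    moreover have "\<infinity> * emeasure \<nu> (cylinder w) = \<infinity>"
      using w(2) by (simp add: ennreal_top_mult)
    ultimately have neg: "(\<integral>\<^sup>+x. e2ennreal (- ?g x) \<partial>\<nu>) = \<infinity>"
      by (simp only: infinity_ennreal_def top_unique)
    obtain r where "0 \<le> r" "(\<integral>\<^sup>+x. e2ennreal (?g x) \<partial>\<nu>) = ennreal r"
      using pos by (cases "\<integral>\<^sup>+x. e2ennreal (?g x) \<partial>\<nu>") auto
    then show ?thesis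
      unfolding extended_integral_def neg by (simp add: enn2ereal_ennreal)
  qed
  have "eventually (\<lambda>n. ereal (1 / real n) * extended_integral \<nu> (\<lambda>x. ereal_ln (op_norm (cocycle A x n)))
      = - \<infinity>) sequentially"
    using eventually_ge_at_top[of "Suc (length w)"]
    by (rule eventually_mono) (simp add: integral)
  then have "(\<lambda>n. ereal (1 / real n) * extended_integral \<nu> (\<lambda>x. ereal_ln (op_norm (cocycle A x n))))
      \<longlonglongrightarrow> - \<infinity>"
    by (rule tendsto_eventually)
  then have "lyapunov_exponent A \<nu> = - \<infinity>"
    unfolding lyapunov_exponent_def by (rule limI)
  moreover obtain h where "metric_entropy \<nu> shift = ereal h"
    by (rule metric_entropy_shift[OF \<nu>])
  ultimately show ?thesis
    using s by (simp add: free_energy_def)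
qed

text \<open>The variational principle at finite length: \<open>ln r \<le> r - 1\<close> compares \<open>p\<close> with the normalised
  weights \<open>N w / Z n\<close>.\<close>

lemma (in quasi_multiplicative) gibbs_inequality:
  assumes p: "\<And>w. 0 \<le> p w" "(\<Sum>w\<in>words n. p w) = 1"
  shows "(\<Sum>w\<in>words n. p w * (ln (N w) - ln (p w))) \<le> ln (Z n)"
proof -
  have "p w * (ln (N w) - ln (p w)) \<le> p w * ln (Z n) + (N w / Z n - p w)" for w
  proof (cases "p w = 0")
    case True
    then show ?thesis
      using N_pos[of w] Z_pos[of n] by simp
  next
    case False
    then have pw: "0 < p w"
      using p(1)[of w] by simp
    have "p w * ln (N w / (p w * Z n)) \<le> p w * (N w / (p w * Z n) - 1)"
      using pw N_pos[of w] Z_pos[of n] by (intro mult_left_mono ln_le_minus_one) auto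
    also have "\<dots> = N w / Z n - p w"
      using pw by (simp add: field_simps)
    finally show ?thesis
      using pw N_pos[of w] Z_pos[of n] by (simp add: ln_div ln_mult_pos algebra_simps)
  qed
  then have "(\<Sum>w\<in>words n. p w * (ln (N w) - ln (p w)))
      \<le> (\<Sum>w\<in>words n. p w * ln (Z n) + (N w / Z n - p w))"
    by (intro sum_mono)
  also have "\<dots> = (\<Sum>w\<in>words n. p w) * ln (Z n) + ((\<Sum>w\<in>words n. N w) / Z n - (\<Sum>w\<in>words n. p w))"
    by (simp only: sum.distrib sum_subtractf sum_distrib_right sum_divide_distrib)
  also have "\<dots> = ln (Z n)"
    using Z_pos[of n] by (simp add: p(2) Z_def[symmetric])
  finally show ?thesis .
qed

lemma fully_supported_iff:
  fixes \<nu> :: "(nat \<Rightarrow> 'm::finite) measure"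
  assumes "\<nu> \<in> invariant_measures"
  shows "fully_supported \<nu> \<longleftrightarrow> (\<forall>w. 0 < emeasure \<nu> (cylinder w))"
proof
  assume fs: "fully_supported \<nu>"
  show "\<forall>w. 0 < emeasure \<nu> (cylinder w)"
  proof
    fix w :: "'m list"
    have "(\<lambda>i. w ! i) \<in> cylinder w"
      by (simp add: mem_cylinder_nth)
    moreover have "(\<lambda>i. w ! i) \<in> topological_support full_shift \<nu>"
      using fs by (simp add: fully_supported_def)
    ultimately show "0 < emeasure \<nu> (cylinder w)"
      using openin_cylinder[of w] by (auto simp: topological_support_def)
  qed
next
  assume pos: "\<forall>w. 0 < emeasure \<nu> (cylinder w)"
  have "0 < emeasure \<nu> U" if U: "openin full_shift U" "x \<in> U" for x U
  proof -
    obtain n where n: "cylinder (initial_word n x) \<subseteq> U"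
      by (rule open_contains_cylinder[OF U])
    have "U \<in> sets \<nu>"
      using U(1) unfolding invariant_measuresD(1)[OF assms] borel_of_topology_def
      by (simp add: sigma_sets.Basic)
    then have "emeasure \<nu> (cylinder (initial_word n x)) \<le> emeasure \<nu> U"
      by (rule emeasure_mono[OF n])
    with pos show ?thesis
      using less_le_trans by blast
  qed
  then show "fully_supported \<nu>"
    by (auto simp: fully_supported_def topological_support_def)
qed

lemma constant_sequence_invariant:
  "return shift_borel (\<lambda>_. i) \<in> (invariant_measures :: (nat \<Rightarrow> 'm::finite) measure set)"
proof -
  let ?R = "return shift_borel (\<lambda>_. i) :: (nat \<Rightarrow> 'm) measure"
  have s: "sets ?R = sets shift_borel" by simp
  have T: "shift \<in> measurable shift_borel ?R"
    using measurable_shift measurable_cong_sets[OF refl s] by blast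
  have "distr ?R ?R shift = return ?R (shift (\<lambda>_. i))"
    by (rule distr_return[OF T]) simp
  also have "\<dots> = ?R"
    using return_cong[OF s] by (simp add: shift_def)
  finally have "distr ?R ?R shift = ?R" .
  moreover have "prob_space ?R"
    by (rule prob_space_return) simp
  ultimately show ?thesis
    by (simp add: invariant_measures_def)
qed

section \<open>The Gibbs measure as an equilibrium state\<close>

text \<open>The Gibbs inequality bounds every free energy by the growth rate \<open>L\<close> of the partition function.
  The upper Gibbs bound \<open>p w \<le> D * exp (- n * L) * N w\<close> is the same inequality reversed, up to the
  constant \<open>ln D\<close>, which disappears after division by \<open>n\<close>.\<close>

theorem gibbs_equilibrium_state:
  fixes A :: "'m::finite \<Rightarrow> real ^ 'd ^ 'd"
  assumes irr: "irreducible_tuple A" and nz: "\<And>w. word_product A w \<noteq> 0" and s: "0 < s"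
  obtains \<nu> where "equilibrium_state A s \<nu>" "\<And>w. 0 < measure \<nu> (cylinder w)"
proof -
  define N where "N w = op_norm (word_product A w) powr s" for w
  interpret quasi_multiplicative N
    unfolding N_def by (rule irreducible_norm_potential[OF irr nz s])
  obtain p L D where L: "(\<lambda>n. ln (Z n) / real n) \<longlonglongrightarrow> L" and D: "0 < D"
    and upper: "\<And>w. p w \<le> D * exp (- real (length w) * L) * N w" and pos: "\<And>w. 0 < p w"
    and p: "p [] = 1" "\<And>w. (\<Sum>i\<in>UNIV. p (w @ [i])) = p w" "\<And>w. (\<Sum>i\<in>UNIV. p (i # w)) = p w"
    by (rule gibbs_weights) (rule that)
  obtain \<nu> where \<nu>: "\<nu> \<in> invariant_measures" and cyl: "\<And>w. measure \<nu> (cylinder w) = p w"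
    using invariant_measure_of_weights[of p] pos p by (metis less_imp_le)
  have lnN: "ln (N w) = s * ln (op_norm (word_product A w))" for w
    using op_norm_pos[OF nz] by (simp add: N_def ln_powr)
  have sum: "shannon \<rho> (initial_word n) + s * mean_log_norm A \<rho> n
      = (\<Sum>w\<in>words n. measure \<rho> (cylinder w) * (ln (N w) - ln (measure \<rho> (cylinder w))))"
    if "\<rho> \<in> invariant_measures" for \<rho> n
    unfolding shannon_initial_word[OF that] mean_log_norm_def lnN
    by (simp add: sum_distrib_left right_diff_distrib sum_subtractf algebra_simps)
  have le: "free_energy A s \<rho> \<le> ereal L" if \<rho>: "\<rho> \<in> invariant_measures" for \<rho>
  proof (rule LIMSEQ_le[OF free_energy_tendsto[OF \<rho> nz]])
    show "(\<lambda>n. ereal (ln (Z n) / real n)) \<longlonglongrightarrow> ereal L"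
      using L by simp
    show "\<exists>k. \<forall>n\<ge>k. ereal ((shannon \<rho> (initial_word n) + s * mean_log_norm A \<rho> n) / real n)
        \<le> ereal (ln (Z n) / real n)"
      using gibbs_inequality[of "\<lambda>w. measure \<rho> (cylinder w)"] sum_cylinder_measures[OF \<rho>]
      unfolding sum[OF \<rho>] by (auto intro!: divide_right_mono)
  qed
  have ge: "ereal L \<le> free_energy A s \<nu>"
  proof (rule LIMSEQ_le[OF _ free_energy_tendsto[OF \<nu> nz]])
    have "(\<lambda>n. L - ln D / real n) \<longlonglongrightarrow> L - 0"
      by (intro tendsto_diff tendsto_const lim_const_over_n)
    then show "(\<lambda>n. ereal (L - ln D / real n)) \<longlonglongrightarrow> ereal L"
      by simp
    have "ereal (L - ln D / real n)
        \<le> ereal ((shannon \<nu> (initial_word n) + s * mean_log_norm A \<nu> n) / real n)" if "n \<ge> 1" for n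
    proof -
      have "p w * (real n * L - ln D) \<le> p w * (ln (N w) - ln (p w))" if "w \<in> words n" for w
      proof (rule mult_left_mono)
        have "ln (p w) \<le> ln (D * exp (- real (length w) * L) * N w)"
          using upper[of w] pos[of w] by (subst ln_le_cancel_iff) (auto intro: less_le_trans)
        also have "\<dots> = ln D - real n * L + ln (N w)"
          using D N_pos[of w] that by (simp add: ln_mult_pos words_def)
        finally show "real n * L - ln D \<le> ln (N w) - ln (p w)"
          by simp
      qed (use pos[of w] in simp)
      then have "(\<Sum>w\<in>words n. p w * (real n * L - ln D)) \<le> (\<Sum>w\<in>words n. p w * (ln (N w) - ln (p w)))"
        by (rule sum_mono)
      moreover have "(\<Sum>w\<in>words n. p w * (real n * L - ln D)) = real n * L - ln D"
        using sum_cylinder_measures[OF \<nu>, of n] by (simp only: cyl flip: sum_distrib_right) simp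
      ultimately have "(real n * L - ln D) / real n
          \<le> (shannon \<nu> (initial_word n) + s * mean_log_norm A \<nu> n) / real n"
        unfolding sum[OF \<nu>] cyl by (intro divide_right_mono) simp_all
      then show ?thesis
        using that by (simp add: diff_divide_distrib)
    qed
    then show "\<exists>k. \<forall>n\<ge>k. ereal (L - ln D / real n)
        \<le> ereal ((shannon \<nu> (initial_word n) + s * mean_log_norm A \<nu> n) / real n)"
      by blast
  qed
  have "free_energy A s \<nu> = (SUP \<rho>\<in>invariant_measures. free_energy A s \<rho>)"
  proof (rule antisym)
    show "free_energy A s \<nu> \<le> (SUP \<rho>\<in>invariant_measures. free_energy A s \<rho>)"
      using \<nu> by (rule SUP_upper)
    show "(SUP \<rho>\<in>invariant_measures. free_energy A s \<rho>) \<le> free_energy A s \<nu>"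
      using le ge order.trans by (intro SUP_least) blast
  qed
  with \<nu> have "equilibrium_state A s \<nu>"
    by (simp add: equilibrium_state_def)
  moreover have "0 < measure \<nu> (cylinder w)" for w
    using pos by (simp add: cyl)
  ultimately show thesis
    by (rule that)
qed

theorem proposition3:
  fixes A :: "'m::finite \<Rightarrow> real ^ 'd ^ 'd"
    and s :: real
    and \<mu> :: "(nat \<Rightarrow> 'm) measure"
  assumes "CARD('m) \<ge> 2"
    and "s > 0"
    and "irreducible_tuple A"
    and "equilibrium_state A s \<mu>"
    and "\<And>\<nu>. equilibrium_state A s \<nu> \<Longrightarrow> \<nu> = \<mu>"
  shows "fully_supported \<mu> \<longleftrightarrow> 0 \<notin> generated_semigroup A"
proof
  have \<mu>: "\<mu> \<in> invariant_measures"
    and sup: "free_energy A s \<mu> = (SUP \<nu>\<in>invariant_measures. free_energy A s \<nu>)"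
    using assms(4) by (auto simp: equilibrium_state_def)
  {
    \<comment> \<open>If some product vanishes, then the maximal free energy is \<open>-\<infinity>\<close>, every invariant measure is an
      equilibrium state, and a point mass contradicts uniqueness.\<close>
    assume fs: "fully_supported \<mu>"
    show "0 \<notin> generated_semigroup A"
    proof
      assume "0 \<in> generated_semigroup A"
      then obtain w where "word_product A w = 0"
        using semigroup_eq_word_product by blast
      then have bot: "free_energy A s \<mu> = - \<infinity>"
        using fs fully_supported_iff[OF \<mu>] by (intro free_energy_zero_word[OF \<mu> assms(2)]) auto
      have "\<not> CARD('m) \<le> Suc 0"
        using assms(1) by simp
      then obtain i j :: 'm where ij: "i \<noteq> j"
        by (subst (asm) card_le_Suc0_iff_eq) auto
      let ?\<delta> = "return shift_borel (\<lambda>_. i)"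
      have "free_energy A s ?\<delta> \<le> free_energy A s \<mu>"
        unfolding sup by (rule SUP_upper[OF constant_sequence_invariant])
      then have "equilibrium_state A s ?\<delta>"
        using bot constant_sequence_invariant sup by (simp add: equilibrium_state_def)
      then have "?\<delta> = \<mu>"
        by (rule assms(5))
      moreover have "emeasure ?\<delta> (cylinder [j]) = 0"
        using ij by (simp add: cylinder_in_sets mem_cylinder_iff initial_word_def)
      moreover have "0 < emeasure \<mu> (cylinder [j])"
        using fs fully_supported_iff[OF \<mu>] by blast
      ultimately show False
        by (metis less_irrefl)
    qed
  next
    assume zero: "0 \<notin> generated_semigroup A"
    have nz: "word_product A w \<noteq> 0" for w
    proof (cases "w = []")
      case True
      have "mat 1 \<noteq> (0 :: real ^ 'd ^ 'd)"
        by (simp add: vec_eq_iff mat_def)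
      with True show ?thesis by simp
    next
      case False
      then show ?thesis
        using zero word_product_in_semigroup[of w A] by metis
    qed
    obtain \<nu> where \<nu>: "equilibrium_state A s \<nu>" "\<And>w. 0 < measure \<nu> (cylinder w)"
      using gibbs_equilibrium_state[OF assms(3) nz assms(2)] by blast
    have "\<nu> = \<mu>"
      by (rule assms(5)[OF \<nu>(1)])
    then have "measure \<mu> (cylinder w) \<noteq> 0" for w
      using \<nu>(2)[of w] by simp
    then have "emeasure \<mu> (cylinder w) \<noteq> 0" for w
      by (metis measure_def enn2real_eq_0_iff)
    then show "fully_supported \<mu>"
      unfolding fully_supported_iff[OF \<mu>] by (simp add: zero_less_iff_neq_zero)
  }
qed

end
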